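(* Let $G$ be a finitely-generated, infinite simple group. Fix a finite, symmetric generating set $X$ for $G$, and let $\omega(t)=2^{|t|_X}$ $(t\in G)$. Then the only proper, finite-codimension left ideal of $\ell^1(G,\omega)$ is the augmentation ideal $\ell^1_0(G,\omega)$, and it is finitely generated.
   Context: Groups are discrete. A generating set $X$ is symmetric if $x^{-1}\in X$ for all $x\in X$; $|t|_X$ denotes the word length of $t$ with respect to $X$ (so $|e|_X=0$). A weight on a group $G$ is a function $\omega\colon G\to[1,\infty)$ with $\omega(st)\le\omega(s)\omega(t)$ for all $s,t\in G$ and $\omega(e)=1$; $t\mapsto 2^{|t|_X}$ is a weight. The Beurling algebra is $\ell^1(G,\omega)=\{f\colon G\to\mathbb{C} : \sum_{t\in G}|f(t)|\omega(t)<\infty\}$, a unital Banach algebra under convolution with norm $\|f\|_\omega=\sum_{t\in G}|f(t)|\omega(t)$. The augmentation ideal is $\ell^1_0(G,\omega)=\{f\in\ell^1(G,\omega):\sum_{t\in G}f(t)=0\}$. Left ideals are not assumed to be closed. A left ideal $I$ of a unital Banach algebra $A$ is finitely generated if there are $n\in\mathbb{N}$ and $a_1,\dots,a_n\in I$ with $I=Aa_1+\cdots+Aa_n$ (algebraically; no closure is taken). *)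

theory Defs
  imports "HOL-Analysis.Infinite_Sum" "HOL-Algebra.Coset" "HOL-Algebra.Generated_Groups"
begin

text \<open>
  The locale \<open>simple_group\<close> of HOL-Algebra expresses non-triviality as \<open>order G > 1\<close>. Since
  \<open>order G = 0\<close> for infinite \<open>G\<close>, it has no infinite models, so simplicity is defined here
  without reference to the order.
\<close>

definition is_simple :: "('a, 'm) monoid_scheme \<Rightarrow> bool" where
  "is_simple G \<longleftrightarrow> group G \<and> carrier G \<noteq> {\<one>\<^bsub>G\<^esub>} \<and>
     (\<forall>H. H \<lhd> G \<longrightarrow> H = carrier G \<or> H = {\<one>\<^bsub>G\<^esub>})"

definition symmetric_generating_set :: "('a, 'm) monoid_scheme \<Rightarrow> 'a set \<Rightarrow> bool" where
  "symmetric_generating_set G X \<longleftrightarrow>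
     X \<subseteq> carrier G \<and> (\<forall>x\<in>X. inv\<^bsub>G\<^esub> x \<in> X) \<and> generate G X = carrier G"

text \<open>Meaningful when \<open>X\<close> is symmetric and generates \<open>G\<close>: then every \<open>t\<close> in the carrier is a
  product of elements of \<open>X\<close>, without having to allow inverses of letters separately.\<close>

definition word_length :: "('a, 'm) monoid_scheme \<Rightarrow> 'a set \<Rightarrow> 'a \<Rightarrow> nat" where
  "word_length G X t =
     (LEAST n. \<exists>xs. length xs = n \<and> set xs \<subseteq> X \<and> foldr (\<lambda>x y. x \<otimes>\<^bsub>G\<^esub> y) xs \<one>\<^bsub>G\<^esub> = t)"

definition exp_weight :: "('a, 'm) monoid_scheme \<Rightarrow> 'a set \<Rightarrow> 'a \<Rightarrow> real" where
  "exp_weight G X t = 2 ^ word_length G X t"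

text \<open>Functions on \<open>G\<close> are represented by functions on the whole type that vanish outside the
  carrier.\<close>

definition beurling :: "('a, 'm) monoid_scheme \<Rightarrow> ('a \<Rightarrow> real) \<Rightarrow> ('a \<Rightarrow> complex) set" where
  "beurling G \<omega> = {f. (\<forall>t. t \<notin> carrier G \<longrightarrow> f t = 0) \<and>
                      (\<lambda>t. norm (f t) * \<omega> t) summable_on carrier G}"

definition convolution ::
  "('a, 'm) monoid_scheme \<Rightarrow> ('a \<Rightarrow> complex) \<Rightarrow> ('a \<Rightarrow> complex) \<Rightarrow> 'a \<Rightarrow> complex" where
  "convolution G f g = (\<lambda>t. if t \<in> carrier G
     then \<Sum>\<^sub>\<infinity>s\<in>carrier G. f s * g (inv\<^bsub>G\<^esub> s \<otimes>\<^bsub>G\<^esub> t) else 0)"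

definition augmentation_ideal ::
  "('a, 'm) monoid_scheme \<Rightarrow> ('a \<Rightarrow> real) \<Rightarrow> ('a \<Rightarrow> complex) set" where
  "augmentation_ideal G \<omega> = {f \<in> beurling G \<omega>. (\<Sum>\<^sub>\<infinity>t\<in>carrier G. f t) = 0}"

text \<open>No topological closedness is required of a left ideal.\<close>

definition left_ideal ::
  "('a, 'm) monoid_scheme \<Rightarrow> ('a \<Rightarrow> real) \<Rightarrow> ('a \<Rightarrow> complex) set \<Rightarrow> bool" where
  "left_ideal G \<omega> I \<longleftrightarrow>
     I \<subseteq> beurling G \<omega> \<and> (\<lambda>t. 0) \<in> I \<and>
     (\<forall>f\<in>I. \<forall>g\<in>I. (\<lambda>t. f t + g t) \<in> I) \<and>
     (\<forall>c. \<forall>f\<in>I. (\<lambda>t. c * f t) \<in> I) \<and>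
     (\<forall>a\<in>beurling G \<omega>. \<forall>f\<in>I. convolution G a f \<in> I)"

text \<open>The quotient vector space \<open>beurling G \<omega> / I\<close> is finite-dimensional, i.e. spanned over the
  complex numbers by the cosets of finitely many elements \<open>b 0, \<dots>, b (n - 1)\<close>.\<close>

definition finite_codimension ::
  "('a, 'm) monoid_scheme \<Rightarrow> ('a \<Rightarrow> real) \<Rightarrow> ('a \<Rightarrow> complex) set \<Rightarrow> bool" where
  "finite_codimension G \<omega> I \<longleftrightarrow>
     (\<exists>(n::nat) b. (\<forall>i<n. b i \<in> beurling G \<omega>) \<and>
        (\<forall>f\<in>beurling G \<omega>. \<exists>c. (\<lambda>t. f t - (\<Sum>i<n. c i * b i t)) \<in> I))"

definition finitely_generated_left_ideal ::
  "('a, 'm) monoid_scheme \<Rightarrow> ('a \<Rightarrow> real) \<Rightarrow> ('a \<Rightarrow> complex) set \<Rightarrow> bool" where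
  "finitely_generated_left_ideal G \<omega> I \<longleftrightarrow>
     left_ideal G \<omega> I \<and>
     (\<exists>(n::nat) a. (\<forall>i<n. a i \<in> I) \<and>
        I = {(\<lambda>t. \<Sum>i<n. convolution G (f i) (a i) t) | f. \<forall>i<n. f i \<in> beurling G \<omega>})"

end

theory Submission
  imports Defs "HOL-Computational_Algebra.Polynomial" "HOL-Library.Function_Algebras"
begin

text \<open>
Let \<open>A = \<ell>\<^sup>1(G, \<omega>)\<close> and let \<open>L\<close> be a proper left ideal of finite codimension. The group \<open>G\<close> acts
linearly on the finite-dimensional space \<open>A/L\<close> by left translation. A finitely generated linear
group is residually finite (Malcev), so it is not both infinite and simple; since the kernel of the
action is \<open>1\<close> or \<open>G\<close>, it must be \<open>G\<close>. Thus \<open>G\<close> acts trivially on \<open>A/L\<close>, and applying this to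
the class of the unit \<open>\<delta>\<^sub>e\<close> shows that \<open>L\<close> contains every \<open>\<delta>\<^sub>g - \<delta>\<^sub>e\<close>.

The elements \<open>\<delta>\<^sub>x - \<delta>\<^sub>e\<close> with \<open>x \<in> X\<close> generate the augmentation ideal algebraically, and this is
where the exponential weight enters. If \<open>t = x\<^sub>1 \<dots> x\<^sub>n\<close> is a shortest word, telescoping gives
\<open>\<delta>\<^sub>t - \<delta>\<^sub>e = \<Sum>\<^sub>i \<delta>\<^bsub>x\<^sub>1\<dots>x\<^sub>i\<^sub>-\<^sub>1\<^esub> * (\<delta>\<^bsub>x\<^sub>i\<^esub> - \<delta>\<^sub>e)\<close>. The coefficients have total norm at most
\<open>1 + 2 + \<dots> + 2\<^sup>n\<^sup>-\<^sup>1 < 2\<^sup>n = \<omega>(t)\<close>, so the decompositions of all \<open>t\<close> can be added up against any \<open>f \<in> A\<close>;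
if \<open>\<Sum>\<^sub>t f(t) = 0\<close>, the result is a decomposition of \<open>f\<close> itself
(\<open>augmentation_ideal_decomposition\<close>). Hence \<open>L\<close> contains the augmentation ideal, which has
codimension one, and the two coincide.

Malcev's theorem is reached through finite quotients of finitely generated subrings of a domain of
characteristic zero: each nonzero element of such a ring is a unit modulo some proper ideal of finite
index, after a possible enlargement of the ring within the domain
(\<open>finite_set_in_finitely_separated_subring\<close>). If \<open>G\<close> acted nontrivially by matrices
with entries in such a ring, reducing modulo an ideal of this kind that detects a nontrivial entry would
give a homomorphism to a finite group of matrices whose kernel is a proper normal subgroup, hence trivial
by simplicity; but then \<open>G\<close> would be finite (\<open>matrix_rep_of_infinite_simple_group_trivial\<close>).
\<close>

section \<open>Finite quotients of finitely generated integral domains\<close>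

text \<open>
Rings are subsets of one ambient type, so that one can pass from a ring to a larger one by
adjoining an element and repeat this in an induction.
\<close>

definition unital_subring :: "'a::comm_ring_1 set \<Rightarrow> bool" where
  "unital_subring R \<longleftrightarrow> 1 \<in> R \<and> (\<forall>x\<in>R. \<forall>y\<in>R. x - y \<in> R \<and> x * y \<in> R)"

definition ideal_in :: "'a::comm_ring_1 set \<Rightarrow> 'a set \<Rightarrow> bool" where
  "ideal_in R I \<longleftrightarrow> I \<subseteq> R \<and> 0 \<in> I \<and> (\<forall>x\<in>I. \<forall>y\<in>I. x + y \<in> I) \<and> (\<forall>r\<in>R. \<forall>x\<in>I. r * x \<in> I)"

definition finite_quotient :: "'a::comm_ring_1 set \<Rightarrow> 'a set \<Rightarrow> bool" where
  "finite_quotient R I \<longleftrightarrow> (\<exists>F. finite F \<and> (\<forall>r\<in>R. \<exists>f\<in>F. r - f \<in> I))"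

text \<open>
The property that every localization \<open>R[1/r]\<close> with \<open>r \<noteq> 0\<close> has a nonzero finite quotient, stated
without localizing: \<open>u\<close> is an inverse of \<open>r\<close> modulo the ideal \<open>I\<close>. Asking for \<open>r\<close> to be a unit
modulo \<open>I\<close>, and not merely nonzero, is what lets the property pass to ring extensions without
having to choose \<open>I\<close> maximal.
\<close>

definition finitely_separated :: "'a::comm_ring_1 set \<Rightarrow> bool" where
  "finitely_separated R \<longleftrightarrow> (\<forall>r\<in>R. r \<noteq> 0 \<longrightarrow>
     (\<exists>I u. ideal_in R I \<and> 1 \<notin> I \<and> finite_quotient R I \<and> u \<in> R \<and> u * r - 1 \<in> I))"

definition polys_over :: "'a::comm_ring_1 set \<Rightarrow> 'a poly set" where
  "polys_over R = {p. \<forall>i. coeff p i \<in> R}"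

definition adjoin :: "'a::comm_ring_1 set \<Rightarrow> 'a \<Rightarrow> 'a set" where
  "adjoin R a = (\<lambda>p. poly p a) ` polys_over R"

lemma unital_subringD:
  assumes "unital_subring R"
  shows "1 \<in> R" "0 \<in> R" "\<And>x y. x \<in> R \<Longrightarrow> y \<in> R \<Longrightarrow> x - y \<in> R"
    "\<And>x y. x \<in> R \<Longrightarrow> y \<in> R \<Longrightarrow> x * y \<in> R" "\<And>x. x \<in> R \<Longrightarrow> - x \<in> R"
    "\<And>x y. x \<in> R \<Longrightarrow> y \<in> R \<Longrightarrow> x + y \<in> R" "\<And>x k. x \<in> R \<Longrightarrow> x ^ k \<in> R"
proof -
  show 1: "1 \<in> R" and d: "\<And>x y. x \<in> R \<Longrightarrow> y \<in> R \<Longrightarrow> x - y \<in> R"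
    and m: "\<And>x y. x \<in> R \<Longrightarrow> y \<in> R \<Longrightarrow> x * y \<in> R"
    using assms by (auto simp: unital_subring_def)
  show z: "0 \<in> R" using d[OF 1 1] by simp
  show n: "- x \<in> R" if "x \<in> R" for x using d[OF z that] by simp
  show "x + y \<in> R" if "x \<in> R" "y \<in> R" for x y using d[OF that(1) n[OF that(2)]] by simp
  show "x ^ k \<in> R" if "x \<in> R" for x k by (induction k) (use 1 m that in auto)
qed

lemma unital_subring_sum:
  assumes "unital_subring R" "\<And>i. i \<in> A \<Longrightarrow> f i \<in> R"
  shows "sum f A \<in> R"
  using assms(2) by (induction A rule: infinite_finite_induct) (auto intro: unital_subringD[OF assms(1)])

lemma ideal_inD:
  assumes "ideal_in R I"
  shows "I \<subseteq> R" "0 \<in> I" "\<And>x y. x \<in> I \<Longrightarrow> y \<in> I \<Longrightarrow> x + y \<in> I"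
    "\<And>r x. r \<in> R \<Longrightarrow> x \<in> I \<Longrightarrow> r * x \<in> I"
  using assms by (auto simp: ideal_in_def)

lemma ideal_in_minus:
  assumes "unital_subring R" "ideal_in R I"
  shows "x \<in> I \<Longrightarrow> - x \<in> I" and "x \<in> I \<Longrightarrow> y \<in> I \<Longrightarrow> x - y \<in> I"
proof -
  show n: "- x \<in> I" if "x \<in> I" for x
    using ideal_inD(4)[OF assms(2) _ that, of "-1"] unital_subringD[OF assms(1)] by simp
  show "x - y \<in> I" if "x \<in> I" "y \<in> I"
    using ideal_inD(3)[OF assms(2) that(1) n[OF that(2)]] by simp
qed

lemma ideal_in_sum:
  assumes "ideal_in R I" "\<And>i. i \<in> A \<Longrightarrow> f i \<in> I"
  shows "sum f A \<in> I"
  using assms(2) by (induction A rule: infinite_finite_induct) (auto intro: ideal_inD[OF assms(1)])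

lemma unital_subring_polys_over:
  assumes "unital_subring R"
  shows "unital_subring (polys_over R)"
  unfolding unital_subring_def polys_over_def
  by (auto simp: coeff_mult coeff_1 intro!: unital_subring_sum[OF assms] unital_subringD[OF assms])

lemma ideal_in_polys_over:
  assumes "unital_subring R" "ideal_in R I"
  shows "ideal_in (polys_over R) (polys_over I)"
  unfolding ideal_in_def polys_over_def
  using ideal_inD(1)[OF assms(2)]
  by (auto simp: coeff_mult intro!: ideal_in_sum[OF assms(2)] ideal_inD(2-4)[OF assms(2)])

lemma polys_over_monom: "0 \<in> R \<Longrightarrow> c \<in> R \<Longrightarrow> monom c n \<in> polys_over R"
  by (simp add: polys_over_def)

lemma polys_over_pCons: "c \<in> R \<Longrightarrow> p \<in> polys_over R \<Longrightarrow> pCons c p \<in> polys_over R"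
  by (auto simp: polys_over_def coeff_pCons split: nat.split)

lemma polys_over_const: "0 \<in> R \<Longrightarrow> c \<in> R \<Longrightarrow> [:c:] \<in> polys_over R"
  by (auto simp: polys_over_def coeff_pCons split: nat.split)

lemma polys_over_smult:
  assumes "unital_subring R" "c \<in> R" "p \<in> polys_over R"
  shows "smult c p \<in> polys_over R"
  using assms by (auto simp: polys_over_def intro: unital_subringD)

lemma polys_over_coeff: "p \<in> polys_over R \<Longrightarrow> coeff p i \<in> R"
  by (simp add: polys_over_def)

lemma polys_over_mono: "I \<subseteq> R \<Longrightarrow> polys_over I \<subseteq> polys_over R"
  by (auto simp: polys_over_def)

lemma unital_subring_adjoin:
  assumes "unital_subring R"
  shows "unital_subring (adjoin R a)"
proof -
  note P = unital_subringD[OF unital_subring_polys_over[OF assms]]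
  have "1 \<in> adjoin R a" unfolding adjoin_def using P(1) by (metis image_eqI poly_1)
  moreover have "x - y \<in> adjoin R a \<and> x * y \<in> adjoin R a" if "x \<in> adjoin R a" "y \<in> adjoin R a" for x y
    using that P(3,4) unfolding adjoin_def by (auto simp flip: poly_diff poly_mult)
  ultimately show ?thesis by (auto simp: unital_subring_def)
qed

lemma subset_adjoin:
  assumes "unital_subring R"
  shows "R \<subseteq> adjoin R a"
proof
  fix x assume "x \<in> R"
  then have "[:x:] \<in> polys_over R" by (intro polys_over_const unital_subringD[OF assms])
  then have "poly [:x:] a \<in> adjoin R a" unfolding adjoin_def by blast
  then show "x \<in> adjoin R a" by simp
qed

lemma in_adjoin:
  assumes "unital_subring R"
  shows "a \<in> adjoin R a"
proof -
  have "[:0, 1:] \<in> polys_over R" by (intro polys_over_pCons polys_over_const unital_subringD[OF assms])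
  then have "poly [:0, 1:] a \<in> adjoin R a" unfolding adjoin_def by blast
  then show ?thesis by simp
qed

text \<open>
Division with remainder after clearing denominators: the coefficients stay in \<open>R\<close> at the price of
a power of the leading coefficient of the divisor.
\<close>

lemma pseudo_division_over:
  assumes R: "unital_subring R" and f: "f \<in> polys_over R" "f \<noteq> 0" and p: "p \<in> polys_over R"
  shows "\<exists>k. \<exists>q\<in>polys_over R. \<exists>r\<in>polys_over R.
           smult (lead_coeff f ^ k) p = f * q + r \<and> (r = 0 \<or> degree r < degree f)"
  using p
proof (induction "degree p" arbitrary: p rule: less_induct)
  case less
  note P = unital_subringD[OF unital_subring_polys_over[OF R]]
  note RR = unital_subringD[OF R]
  let ?c = "lead_coeff f"
  have cR: "?c \<in> R" using f by (simp add: polys_over_def)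
  show ?case
  proof (cases "p = 0 \<or> degree p < degree f")
    case True
    then show ?thesis using P(2) less.prems
      by (intro exI[of _ 0] bexI[of _ 0] bexI[of _ p]) auto
  next
    case False
    define m where "m = monom (lead_coeff p) (degree p - degree f)"
    have mP: "m \<in> polys_over R" unfolding m_def using less.prems
      by (intro polys_over_monom RR) (simp add: polys_over_def)
    define p' where "p' = smult ?c p - f * m"
    have p'P: "p' \<in> polys_over R" unfolding p'_def
      using polys_over_smult[OF R cR less.prems] f mP P by auto
    have deg: "degree p' \<le> degree p" unfolding p'_def m_def
      using False by (intro degree_diff_le degree_smult_le order.trans[OF degree_mult_le])
        (auto intro: order.trans[OF add_left_mono[OF degree_monom_le]])
    have "coeff (f * m) (degree p) = ?c * lead_coeff p"
      unfolding m_def using False by (simp add: mult.commute[of f] coeff_monom_mult)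
    then have co: "coeff p' (degree p) = 0" unfolding p'_def by simp
    have "p' = 0 \<or> degree p' < degree p"
      using deg co by (metis leading_coeff_0_iff le_neq_implies_less)
    then have "\<exists>k. \<exists>q\<in>polys_over R. \<exists>r\<in>polys_over R.
           smult (?c ^ k) p' = f * q + r \<and> (r = 0 \<or> degree r < degree f)"
    proof
      assume "p' = 0"
      then show ?thesis using P(2) by (intro exI[of _ 0] bexI[of _ 0]) auto
    next
      assume "degree p' < degree p"
      then show ?thesis using less.hyps p'P by blast
    qed
    then obtain k q r where kqr: "q \<in> polys_over R" "r \<in> polys_over R"
      "smult (?c ^ k) p' = f * q + r" "r = 0 \<or> degree r < degree f" by blast
    have "smult (?c ^ Suc k) p = smult (?c ^ k) (p' + f * m)"
      by (simp add: p'_def mult.commute)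
    also have "\<dots> = f * (q + smult (?c ^ k) m) + r"
      using kqr(3) by (simp add: smult_add_right algebra_simps)
    finally show ?thesis using kqr polys_over_smult[OF R RR(7)[OF cR] mP] P(6)
      by (intro exI[of _ "Suc k"] bexI[of _ "q + smult (?c ^ k) m"] bexI[of _ r]) auto
  qed
qed

text \<open>
The quotient of \<open>(R/I)[x]\<close> by a polynomial \<open>h\<close> of positive degree with unit leading coefficient
contains \<open>R/I\<close>: a nonzero multiple of \<open>h\<close> over \<open>R/I\<close> has positive degree and so is not constant.
This is used to see that ideals of \<open>R[a]\<close> are proper.
\<close>

lemma const_in_ideal_if_multiple_of_unit_leading:
  assumes R: "unital_subring R" and I: "ideal_in R I"
    and h: "h \<in> polys_over R" "degree h \<ge> 1" and q: "q \<in> polys_over R"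
    and u: "u \<in> R" "u * lead_coeff h - 1 \<in> I"
    and vhq: "[:v:] - h * q \<in> polys_over I"
  shows "v \<in> I"
proof -
  have "q \<in> polys_over I"
  proof (rule ccontr)
    assume "q \<notin> polys_over I"
    \<comment> \<open>Look at the top coefficient of \<open>q\<close> modulo \<open>I\<close>; the product \<open>h * q\<close> cannot cancel it because
      the leading coefficient of \<open>h\<close> is a unit modulo \<open>I\<close>.\<close>
    define B where "B = {i. coeff q i \<notin> I}"
    have B0: "B \<noteq> {}" using \<open>q \<notin> polys_over I\<close> by (auto simp: B_def polys_over_def)
    have "B \<subseteq> {..degree q}"
      using ideal_inD(2)[OF I] by (auto simp: B_def) (metis le_degree)
    then have finB: "finite B" by (rule finite_subset) simp
    define m where "m = Max B"
    have m: "coeff q m \<notin> I" using Max_in[OF finB B0] by (simp add: m_def B_def)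
    have big: "coeff q i \<in> I" if "i > m" for i
      using Max_ge[OF finB, of i] that by (auto simp: m_def B_def)
    let ?d = "degree h"
    have "coeff (h * q) (?d + m) = (\<Sum>i\<le>?d + m. coeff h i * coeff q (?d + m - i))"
      by (simp add: coeff_mult)
    also have "\<dots> = coeff h ?d * coeff q m + (\<Sum>i\<in>{..?d + m} - {?d}. coeff h i * coeff q (?d + m - i))"
      by (subst sum.remove[of _ ?d]) auto
    finally have eq: "coeff h ?d * coeff q m = coeff (h * q) (?d + m)
        - (\<Sum>i\<in>{..?d + m} - {?d}. coeff h i * coeff q (?d + m - i))" by simp
    have s: "(\<Sum>i\<in>{..?d + m} - {?d}. coeff h i * coeff q (?d + m - i)) \<in> I"
    proof (rule ideal_in_sum[OF I])
      fix i assume i: "i \<in> {..?d + m} - {?d}"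
      show "coeff h i * coeff q (?d + m - i) \<in> I"
      proof (cases "i < ?d")
        case True
        then show ?thesis
          using h by (intro ideal_inD(4)[OF I] big) (auto simp: polys_over_def)
      next
        case False
        then have "coeff h i = 0" using i by (intro coeff_eq_0) auto
        then show ?thesis using ideal_inD(2)[OF I] by simp
      qed
    qed
    have "coeff ([:v:] - h * q) (?d + m) \<in> I" using vhq by (simp add: polys_over_def)
    then have "- coeff (h * q) (?d + m) \<in> I"
      using h(2) by (simp add: coeff_pCons split: nat.splits)
    from ideal_in_minus(1)[OF R I this] have hq: "coeff (h * q) (?d + m) \<in> I" by simp
    have "coeff h ?d * coeff q m \<in> I"
      unfolding eq by (rule ideal_in_minus(2)[OF R I hq s])
    then have "u * (coeff h ?d * coeff q m) \<in> I"
      by (rule ideal_inD(4)[OF I u(1)])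
    moreover have "coeff q m * (u * lead_coeff h - 1) \<in> I"
      using q by (intro ideal_inD(4)[OF I _ u(2)]) (simp add: polys_over_def)
    ultimately have "u * (coeff h ?d * coeff q m) - coeff q m * (u * lead_coeff h - 1) \<in> I"
      by (rule ideal_in_minus(2)[OF R I])
    then have "coeff q m \<in> I" by (simp add: algebra_simps)
    with m show False ..
  qed
  then have "h * q \<in> polys_over I"
    using h by (intro ideal_inD(4)[OF ideal_in_polys_over[OF R I]])
  then have "([:v:] - h * q) + h * q \<in> polys_over I"
    using vhq by (intro ideal_inD(3)[OF ideal_in_polys_over[OF R I]])
  then have "[:v:] \<in> polys_over I" by simp
  then have "coeff [:v:] 0 \<in> I" unfolding polys_over_def by blast
  then show ?thesis by simp
qed

text \<open>
Division by \<open>h\<close>, which the inverse \<open>u\<close> of the leading coefficient makes possible modulo \<open>J\<close>. As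
\<open>u\<close> is an inverse only modulo \<open>I\<close>, subtracting the usual multiple of \<open>h\<close> leaves a leading term
with coefficient in \<open>I\<close>; the monomial \<open>e\<close> in the proof removes it.
\<close>

lemma reduce_degree_modulo:
  assumes R: "unital_subring R" and IJ: "I \<subseteq> J"
    and J: "ideal_in (adjoin R a) J"
    and h: "h \<in> polys_over R" "degree h \<ge> 1" "poly h a \<in> J"
    and u: "u \<in> R" "u * lead_coeff h - 1 \<in> I"
    and p: "p \<in> polys_over R"
  shows "\<exists>r\<in>polys_over R. degree r < degree h \<and> poly p a - poly r a \<in> J"
  using p
proof (induction "degree p" arbitrary: p rule: less_induct)
  case less
  note P = unital_subringD[OF unital_subring_polys_over[OF R]]
  note RR = unital_subringD[OF R]
  note JD = ideal_inD[OF J]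
  note A = unital_subring_adjoin[OF R, of a]
  show ?case
  proof (cases "degree p < degree h")
    case True
    then show ?thesis using JD(2) less.prems by (intro bexI[of _ p]) auto
  next
    case False
    let ?n = "degree p"
    have pn: "coeff p i \<in> R" for i using less.prems by (simp add: polys_over_def)
    have hn: "coeff h i \<in> R" for i using h by (simp add: polys_over_def)
    define m where "m = monom (u * lead_coeff p) (?n - degree h)"
    define e where "e = monom (lead_coeff p * (1 - u * lead_coeff h)) ?n"
    define p' where "p' = p - m * h - e"
    have mP: "m \<in> polys_over R" unfolding m_def
      by (intro polys_over_monom RR u pn)
    have eP: "e \<in> polys_over R" unfolding e_def
      by (intro polys_over_monom RR u pn hn)
    have p'P: "p' \<in> polys_over R" unfolding p'_def
      by (intro P(3,4) mP eP h less.prems)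
    have "degree (m * h) \<le> (?n - degree h) + degree h" unfolding m_def
      by (rule order.trans[OF degree_mult_le add_right_mono[OF degree_monom_le]])
    then have deg: "degree p' \<le> ?n" unfolding p'_def e_def
      using False by (intro degree_diff_le degree_monom_le) auto
    have "coeff (m * h) ?n = u * lead_coeff p * lead_coeff h"
      unfolding m_def using False by (simp add: coeff_monom_mult)
    then have co: "coeff p' ?n = 0" unfolding p'_def e_def by (simp add: algebra_simps)
    have "degree p' < ?n" using deg co False h(2)
      by (metis leading_coeff_0_iff le_neq_implies_less degree_0 le_less_linear le_zero_eq not_one_le_zero less_le_trans)
    then obtain r where r: "r \<in> polys_over R" "degree r < degree h" "poly p' a - poly r a \<in> J"
      using less.hyps p'P by blast
    have "poly m a * poly h a \<in> J" by (rule JD(4)[OF _ h(3)]) (use mP in \<open>auto simp: adjoin_def\<close>)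
    moreover have "poly e a \<in> J"
    proof -
      have "(- lead_coeff p * a ^ ?n) * (u * lead_coeff h - 1) \<in> J"
        using subset_adjoin[OF R] in_adjoin[OF R] pn IJ u(2)
        by (intro JD(4) unital_subringD[OF A]) auto
      moreover have "(- lead_coeff p * a ^ ?n) * (u * lead_coeff h - 1) = poly e a"
        unfolding e_def poly_monom by (simp add: algebra_simps)
      ultimately show ?thesis by metis
    qed
    ultimately have "(poly p' a - poly r a) + (poly m a * poly h a + poly e a) \<in> J"
      using r JD(3) by blast
    then have "poly p a - poly r a \<in> J" unfolding p'_def by (simp add: algebra_simps)
    with r show ?thesis by blast
  qed
qed

text \<open>
By division with remainder, \<open>R[a]/J\<close> is spanned over the finite ring \<open>R/I\<close> by finitely many
powers of \<open>a\<close>.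
\<close>

lemma finite_quotient_adjoin:
  assumes R: "unital_subring R" and I: "finite_quotient R I" and IJ: "I \<subseteq> J"
    and J: "ideal_in (adjoin R a) J"
    and h: "h \<in> polys_over R" "degree h \<ge> 1" "poly h a \<in> J"
    and u: "u \<in> R" "u * lead_coeff h - 1 \<in> I"
  shows "finite_quotient (adjoin R a) J"
proof -
  obtain F where F: "finite F" "\<And>r. r \<in> R \<Longrightarrow> \<exists>f\<in>F. r - f \<in> I"
    using I by (auto simp: finite_quotient_def)
  let ?d = "degree h"
  define F' where "F' = (\<lambda>\<phi>. \<Sum>i<?d. \<phi> i * a ^ i) ` ({..<?d} \<rightarrow>\<^sub>E F)"
  have "finite F'" unfolding F'_def using F(1) by (intro finite_imageI finite_PiE) auto
  moreover have "\<exists>f\<in>F'. x - f \<in> J" if x: "x \<in> adjoin R a" for x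
  proof -
    obtain p where p: "p \<in> polys_over R" "x = poly p a" using x unfolding adjoin_def by blast
    obtain r where r: "r \<in> polys_over R" "degree r < ?d" "poly p a - poly r a \<in> J"
      using reduce_degree_modulo[OF R IJ J h u p(1)] by blast
    have "\<forall>i. \<exists>f\<in>F. coeff r i - f \<in> I" using F(2) r(1) by (auto simp: polys_over_def)
    then obtain \<phi> where \<phi>: "\<And>i. \<phi> i \<in> F" "\<And>i. coeff r i - \<phi> i \<in> I" by metis
    define f where "f = (\<Sum>i<?d. restrict \<phi> {..<?d} i * a ^ i)"
    have "f \<in> F'" unfolding F'_def f_def using \<phi>(1) by (intro imageI restrict_PiE_iff[THEN iffD2] ballI)
    have "poly r a = (\<Sum>i\<le>degree r. coeff r i * a ^ i)" by (simp add: poly_altdef)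
    also have "\<dots> = (\<Sum>i<?d. coeff r i * a ^ i)"
      proof (intro sum.mono_neutral_left ballI)
      show "coeff r i * a ^ i = 0" if "i \<in> {..<?d} - {..degree r}" for i
        using that by (simp add: coeff_eq_0)
    qed (use r(2) in auto)
    finally have "poly r a - f = (\<Sum>i<?d. a ^ i * (coeff r i - \<phi> i))"
      unfolding f_def by (simp add: sum_subtractf algebra_simps)
    also have "\<dots> \<in> J"
      using IJ \<phi>(2) by (intro ideal_in_sum[OF J] ideal_inD(4)[OF J]
        unital_subringD(7)[OF unital_subring_adjoin[OF R]] in_adjoin[OF R]) auto
    finally have "(poly p a - poly r a) + (poly r a - f) \<in> J"
      using r(3) ideal_inD(3)[OF J] by blast
    then show ?thesis using \<open>f \<in> F'\<close> p(2) by auto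
  qed
  ultimately show ?thesis by (auto simp: finite_quotient_def)
qed

lemma ideal_in_eval:
  assumes "unital_subring R" "ideal_in (polys_over R) K"
  shows "ideal_in (adjoin R a) ((\<lambda>p. poly p a) ` K)"
  unfolding ideal_in_def
proof (intro conjI ballI)
  note K = ideal_inD[OF assms(2)]
  show "(\<lambda>p. poly p a) ` K \<subseteq> adjoin R a" using K(1) by (auto simp: adjoin_def)
  show "0 \<in> (\<lambda>p. poly p a) ` K" using K(2) by (metis image_eqI poly_0)
  fix x assume x: "x \<in> (\<lambda>p. poly p a) ` K"
  show "x + y \<in> (\<lambda>p. poly p a) ` K" if "y \<in> (\<lambda>p. poly p a) ` K" for y
    using x that K(3) by (auto simp flip: poly_add)
  show "r * x \<in> (\<lambda>p. poly p a) ` K" if "r \<in> adjoin R a" for r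
    using x that K(4) by (auto simp: adjoin_def simp flip: poly_mult)
qed

text \<open>
For \<open>s = p(a)\<close>, impose the relation \<open>h(a) = 0\<close> with \<open>h = 1 + x p\<close>. It makes \<open>- a\<close> an inverse of \<open>s\<close>,
and the leading coefficient of \<open>h\<close> is that of \<open>p\<close>, which can be assumed to be a unit modulo an ideal
\<open>I\<close> of finite index in \<open>R\<close>. The ideal generated by \<open>I\<close> and \<open>h(a)\<close> then has finite index, and it is
proper because \<open>R[a]\<close> is a polynomial ring.
\<close>

lemma finitely_separated_adjoin_transcendental:
  fixes R :: "'a::idom set"
  assumes R: "unital_subring R" "finitely_separated R"
    and trans: "\<And>p. p \<in> polys_over R \<Longrightarrow> poly p a = 0 \<Longrightarrow> p = 0"
  shows "finitely_separated (adjoin R a)"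
  unfolding finitely_separated_def
proof (intro ballI impI)
  note RR = unital_subringD[OF R(1)]
  note PS = unital_subring_polys_over[OF R(1)]
  note P = unital_subringD[OF PS]
  fix s assume s: "s \<in> adjoin R a" "s \<noteq> 0"
  then obtain p where p: "p \<in> polys_over R" "s = poly p a" unfolding adjoin_def by blast
  then have "p \<noteq> 0" using s(2) by auto
  then have "lead_coeff p \<in> R" "lead_coeff p \<noteq> 0" using p by (auto simp: polys_over_def)
  then obtain I u where I: "ideal_in R I" "1 \<notin> I" "finite_quotient R I"
    and u: "u \<in> R" "u * lead_coeff p - 1 \<in> I"
    using R(2) by (auto simp: finitely_separated_def)
  note IP = ideal_in_polys_over[OF R(1) I(1)]
  define h where "h = pCons 1 p"
  have h: "h \<in> polys_over R" "degree h \<ge> 1" "lead_coeff h = lead_coeff p"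
    using p \<open>p \<noteq> 0\<close> RR by (auto simp: h_def intro: polys_over_pCons)
  define K where "K = {i + h * q | i q. i \<in> polys_over I \<and> q \<in> polys_over R}"
  have K: "ideal_in (polys_over R) K"
    unfolding ideal_in_def
  proof (intro conjI ballI)
    show "K \<subseteq> polys_over R" unfolding K_def using P(4,6) h polys_over_mono[OF ideal_inD(1)[OF I(1)]]
      by blast
    have "0 + h * 0 \<in> K" unfolding K_def using P(2) ideal_inD(2)[OF IP] by blast
    then show "0 \<in> K" by simp
    fix x assume "x \<in> K"
    then obtain i q where iq: "x = i + h * q" "i \<in> polys_over I" "q \<in> polys_over R" by (auto simp: K_def)
    {
      fix y assume "y \<in> K"
      then obtain i' q' where iq': "y = i' + h * q'" "i' \<in> polys_over I" "q' \<in> polys_over R"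
        by (auto simp: K_def)
      have "x + y = (i + i') + h * (q + q')" by (simp add: iq iq' algebra_simps)
      then show "x + y \<in> K" unfolding K_def using iq iq' P(6) ideal_inD(3)[OF IP] by blast
    next
      fix r assume r: "r \<in> polys_over R"
      have "r * x = r * i + h * (r * q)" by (simp add: iq algebra_simps)
      then show "r * x \<in> K" unfolding K_def using iq r P(4) ideal_inD(4)[OF IP] by blast
    }
  qed
  define J where "J = (\<lambda>p. poly p a) ` K"
  have J: "ideal_in (adjoin R a) J" unfolding J_def by (rule ideal_in_eval[OF R(1) K])
  have "1 \<notin> J"
  proof
    assume "1 \<in> J"
    then obtain i q where iq: "1 = poly (i + h * q) a" "i \<in> polys_over I" "q \<in> polys_over R"
      unfolding J_def K_def by blast
    have iR: "i \<in> polys_over R" using iq(2) polys_over_mono[OF ideal_inD(1)[OF I(1)]] by blast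
    have "1 - (i + h * q) = 0"
      using iq h iR by (intro trans P) simp_all
    then have "[:1:] - h * q = i" by (simp add: algebra_simps one_pCons)
    then have "1 \<in> I"
      using const_in_ideal_if_multiple_of_unit_leading[OF R(1) I(1) h(1,2) iq(3) u(1)] u(2) h(3) iq(2)
      by simp
    with I show False by simp
  qed
  moreover have ha: "poly h a \<in> J"
  proof -
    have "0 + h * 1 \<in> K" unfolding K_def using P(1) ideal_inD(2)[OF IP] by blast
    then show ?thesis unfolding J_def by simp
  qed
  moreover have IJ: "I \<subseteq> J"
  proof
    fix x assume x: "x \<in> I"
    have "[:x:] \<in> polys_over I" using x ideal_inD(2)[OF I(1)] by (intro polys_over_const)
    then have "[:x:] + h * 0 \<in> K" unfolding K_def using P(2) by blast
    then have "poly [:x:] a \<in> J" unfolding J_def by (metis image_eqI mult_zero_right add_0_right)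
    then show "x \<in> J" by simp
  qed
  moreover have "finite_quotient (adjoin R a) J"
    using finite_quotient_adjoin[OF R(1) I(3) IJ J h(1,2) ha u(1)] u(2) h(3) by simp
  moreover have "- a \<in> adjoin R a"
    by (intro unital_subringD[OF unital_subring_adjoin[OF R(1)]] in_adjoin[OF R(1)])
  moreover have "(- a) * s - 1 \<in> J"
    proof -
    have "(- a) * s - 1 = - poly h a" by (simp add: h_def p(2))
    then show ?thesis using ideal_in_minus(1)[OF unital_subring_adjoin[OF R(1)] J ha] by simp
  qed
  ultimately show "\<exists>I u. ideal_in (adjoin R a) I \<and> 1 \<notin> I \<and> finite_quotient (adjoin R a) I
      \<and> u \<in> adjoin R a \<and> u * s - 1 \<in> I"
    using J by blast
qed

text \<open>
When \<open>a\<close> is algebraic over \<open>R\<close>, every nonzero principal ideal \<open>(s)\<close> of \<open>R[a]\<close> meets \<open>R\<close>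
nontrivially. Take a polynomial \<open>r\<close> of least degree with \<open>0 \<noteq> r(a) \<in> (s)\<close>. Dividing \<open>f\<close> by \<open>r\<close> yields a remainder
that vanishes at \<open>a\<close>, hence is zero, so \<open>r\<close> divides \<open>f\<close> up to a constant; as the
cofactor vanishes at \<open>a\<close> it has the full degree of \<open>f\<close>, and \<open>r\<close> is constant.
\<close>

lemma constant_multiple_of_algebraic:
  fixes R :: "'a::idom set"
  assumes R: "unital_subring R" and f: "f \<in> polys_over R" "f \<noteq> 0" "poly f a = 0"
    and minimal: "\<And>p. p \<in> polys_over R \<Longrightarrow> poly p a = 0 \<Longrightarrow> p \<noteq> 0 \<Longrightarrow> degree f \<le> degree p"
    and s: "s \<in> adjoin R a" "s \<noteq> 0"
  shows "\<exists>b\<in>R. b \<noteq> 0 \<and> (\<exists>w\<in>adjoin R a. b = w * s)"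
proof -
  note AS = unital_subring_adjoin[OF R, of a]
  note A = unital_subringD[OF AS]
  note P = unital_subringD[OF unital_subring_polys_over[OF R]]
  note RR = unital_subringD[OF R]
  have RA: "x \<in> adjoin R a" if "x \<in> R" for x using subset_adjoin[OF R] that by blast
  have PA: "poly p a \<in> adjoin R a" if "p \<in> polys_over R" for p using that by (auto simp: adjoin_def)
  define C where "C r \<longleftrightarrow> r \<in> polys_over R \<and> poly r a \<noteq> 0 \<and> (\<exists>w\<in>adjoin R a. poly r a = w * s)" for r
  obtain p where "p \<in> polys_over R" "s = poly p a" using s by (auto simp: adjoin_def)
  then have "C p" using s A(1) unfolding C_def by (metis mult_1)
  obtain r where "C r" and rmin: "\<And>r'. C r' \<Longrightarrow> degree r \<le> degree r'"
    using ex_has_least_nat[of C p degree, OF \<open>C p\<close>] by blast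
  then obtain w where r: "r \<in> polys_over R" "poly r a \<noteq> 0" "w \<in> adjoin R a" "poly r a = w * s"
    by (auto simp: C_def)
  have r0: "r \<noteq> 0" using r by auto
  have less: "degree r < degree f"
  proof (rule ccontr)
    assume ge: "\<not> degree r < degree f"
    obtain k q r' where d: "q \<in> polys_over R" "r' \<in> polys_over R"
      "smult (lead_coeff f ^ k) r = f * q + r'" "r' = 0 \<or> degree r' < degree f"
      using pseudo_division_over[OF R f(1,2) r(1)] by blast
    have "poly (f * q + r') a = lead_coeff f ^ k * poly r a" by (simp flip: d(3))
    then have e: "poly r' a = lead_coeff f ^ k * poly r a" using f(3) by simp
    then have n0: "poly r' a \<noteq> 0" using r f(2) by simp
    have "C r'" unfolding C_def
    proof (intro conjI bexI)
      show "poly r' a = (lead_coeff f ^ k * w) * s" using e r(4) by simp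
      show "lead_coeff f ^ k * w \<in> adjoin R a"
        using f(1) r(3) by (intro A(4)[OF A(7)[OF RA]] polys_over_coeff)
    qed (use d n0 in auto)
    from rmin[OF this] d(4) ge n0 show False by auto
  qed
  obtain k q r' where d: "q \<in> polys_over R" "r' \<in> polys_over R"
    "smult (lead_coeff r ^ k) f = r * q + r'" "r' = 0 \<or> degree r' < degree r"
    using pseudo_division_over[OF R r(1) r0 f(1)] by blast
  have "poly (r * q + r') a = 0" unfolding d(3)[symmetric] using f(3) by simp
  then have e: "poly r' a = (- poly q a) * poly r a" by (simp add: add_eq_0_iff algebra_simps)
  have "poly r' a = 0"
  proof (rule ccontr)
    assume n0: "poly r' a \<noteq> 0"
    have "C r'" unfolding C_def
    proof (intro conjI bexI)
      show "poly r' a = ((- poly q a) * w) * s" using e r(4) by simp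
      show "(- poly q a) * w \<in> adjoin R a" using d(1) r(3) PA by (intro A)
    qed (use d n0 in auto)
    from rmin[OF this] d(4) n0 show False by auto
  qed
  then have r'0: "r' = 0" using minimal[OF d(2)] d(4) less by force
  have q0: "q \<noteq> 0" using d(3) r'0 f(2) r0 by auto
  have "poly q a = 0" using e \<open>poly r' a = 0\<close> r(2) by simp
  then have "degree f \<le> degree q" using minimal d(1) q0 by blast
  moreover have "degree f = degree r + degree q"
    using arg_cong[OF d(3), of degree] r'0 q0 r0 by (simp add: degree_mult_eq)
  ultimately have "degree r = 0" by simp
  then obtain b where b: "r = [:b:]" by (rule degree_eq_zeroE)
  have "b \<in> R" using polys_over_coeff[OF r(1), of 0] b by simp
  moreover have "b \<noteq> 0" "b = w * s" using r b by auto
  ultimately show ?thesis using r(3) by blast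
qed

lemma power_minus_one_in_ideal:
  assumes R: "unital_subring R" and I: "ideal_in R I" and x: "x \<in> R" "x - 1 \<in> I"
  shows "x ^ k - 1 \<in> I"
proof (induction k)
  case 0
  then show ?case using ideal_inD(2)[OF I] by simp
next
  case (Suc k)
  have "x * (x ^ k - 1) + (x - 1) \<in> I"
    using ideal_inD(3,4)[OF I] x Suc by blast
  then show ?case by (simp add: algebra_simps)
qed

text \<open>
Choose a nonzero \<open>b \<in> R\<close> that is a multiple of \<open>s\<close> and an ideal \<open>I\<close> of \<open>R\<close> modulo which both \<open>b\<close>
and the leading coefficient \<open>c\<close> of a minimal polynomial \<open>f\<close> of \<open>a\<close> are units. The ideal of \<open>R[a]\<close>
generated by \<open>I\<close> works: \<open>s\<close> is a unit modulo it because it divides \<open>b\<close>, and the index is finite because \<open>f(a) = 0\<close>. A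
representation \<open>1 = i(a)\<close> with \<open>i\<close> over \<open>I\<close> would, after division of \<open>1 - i\<close> by \<open>f\<close>, make a power of \<open>c\<close> a multiple of \<open>f\<close>
modulo \<open>I\<close>, hence an element of \<open>I\<close>.
\<close>

lemma finitely_separated_adjoin_algebraic:
  fixes R :: "'a::idom set"
  assumes R: "unital_subring R" "finitely_separated R"
    and alg: "p \<in> polys_over R" "poly p a = 0" "p \<noteq> 0"
  shows "finitely_separated (adjoin R a)"
  unfolding finitely_separated_def
proof (intro ballI impI)
  note AS = unital_subring_adjoin[OF R(1), of a]
  note A = unital_subringD[OF AS]
  note PS = unital_subring_polys_over[OF R(1)]
  note P = unital_subringD[OF PS]
  note RR = unital_subringD[OF R(1)]
  have RA: "x \<in> adjoin R a" if "x \<in> R" for x using subset_adjoin[OF R(1)] that by blast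
  fix s assume s: "s \<in> adjoin R a" "s \<noteq> 0"
  define C where "C f \<longleftrightarrow> f \<in> polys_over R \<and> poly f a = 0 \<and> f \<noteq> 0" for f
  have "C p" using alg by (simp add: C_def)
  then obtain f where "C f" and fmin: "\<And>f'. C f' \<Longrightarrow> degree f \<le> degree f'"
    using ex_has_least_nat[of C p degree] by blast
  then have f: "f \<in> polys_over R" "f \<noteq> 0" "poly f a = 0" by (auto simp: C_def)
  have minimal: "degree f \<le> degree p" if "p \<in> polys_over R" "poly p a = 0" "p \<noteq> 0" for p
    using fmin that by (auto simp: C_def)
  have deg1: "degree f \<ge> 1"
  proof (rule ccontr)
    assume "\<not> degree f \<ge> 1"
    then have "degree f = 0" by simp
    then obtain b where "f = [:b:]" by (rule degree_eq_zeroE)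
    with f show False by auto
  qed
  obtain b w where b: "b \<in> R" "b \<noteq> 0" and w: "w \<in> adjoin R a" "b = w * s"
    using constant_multiple_of_algebraic[OF R(1) f minimal s] by blast
  let ?c = "lead_coeff f"
  have c: "?c \<in> R" "?c \<noteq> 0" using f by (auto simp: polys_over_def)
  have "b * ?c \<in> R" "b * ?c \<noteq> 0" using b c RR(4) by auto
  then obtain I u where I: "ideal_in R I" "1 \<notin> I" "finite_quotient R I"
    and u: "u \<in> R" "u * (b * ?c) - 1 \<in> I"
    using R(2) by (auto simp: finitely_separated_def)
  note IP = ideal_in_polys_over[OF R(1) I(1)]
  define J where "J = (\<lambda>p. poly p a) ` polys_over I"
  have J: "ideal_in (adjoin R a) J" unfolding J_def by (rule ideal_in_eval[OF R(1) IP])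
  have ub: "u * b \<in> R" "u * b * ?c - 1 \<in> I" using u b RR(4) by (auto simp: mult.assoc)
  have "1 \<notin> J"
  proof
    assume "1 \<in> J"
    then obtain i where i: "1 = poly i a" "i \<in> polys_over I" by (auto simp: J_def)
    have iR: "i \<in> polys_over R" using i(2) polys_over_mono[OF ideal_inD(1)[OF I(1)]] by blast
    obtain k q r where d: "q \<in> polys_over R" "r \<in> polys_over R"
      "smult (?c ^ k) (1 - i) = f * q + r" "r = 0 \<or> degree r < degree f"
      using pseudo_division_over[OF R(1) f(1,2) P(3)[OF P(1) iR]] by blast
    have "poly (f * q + r) a = 0" unfolding d(3)[symmetric] using i(1) by simp
    then have "poly r a = 0" using f(3) by simp
    then have "r = 0" using minimal[OF d(2)] d(4) by force
    then have "f * q = smult (?c ^ k) 1 - smult (?c ^ k) i"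
      using d(3) by (simp add: smult_diff_right)
    then have "[:?c ^ k:] - f * q = [:?c ^ k:] * i" by simp
    moreover have "[:?c ^ k:] * i \<in> polys_over I"
      using i(2) RR c by (intro ideal_inD(4)[OF IP] polys_over_const) auto
    ultimately have "?c ^ k \<in> I"
      using const_in_ideal_if_multiple_of_unit_leading[OF R(1) I(1) f(1) deg1 d(1) ub] by simp
    then have "(u * b) ^ k * ?c ^ k \<in> I"
      using ideal_inD(4)[OF I(1)] RR(7)[OF ub(1)] by blast
    then have "(u * b * ?c) ^ k \<in> I" by (simp add: power_mult_distrib)
    moreover have "(u * b * ?c) ^ k - 1 \<in> I"
      using ub c RR(4) by (intro power_minus_one_in_ideal[OF R(1) I(1)]) auto
    ultimately have "(u * b * ?c) ^ k - ((u * b * ?c) ^ k - 1) \<in> I"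
      by (rule ideal_in_minus(2)[OF R(1) I(1)])
    then show False using I(2) by simp
  qed
  moreover have fa: "poly f a \<in> J" using f(3) ideal_inD(2)[OF J] by simp
  moreover have IJ: "I \<subseteq> J"
  proof
    fix x assume x: "x \<in> I"
    have "[:x:] \<in> polys_over I" using x ideal_inD(2)[OF I(1)] by (intro polys_over_const)
    then have "poly [:x:] a \<in> J" unfolding J_def by blast
    then show "x \<in> J" by simp
  qed
  moreover have "finite_quotient (adjoin R a) J"
    by (rule finite_quotient_adjoin[OF R(1) I(3) IJ J f(1) deg1 fa ub])
  moreover have "u * ?c * w \<in> adjoin R a" using A(4)[OF A(4)[OF RA[OF u(1)] RA[OF c(1)]] w(1)] .
  moreover have "(u * ?c * w) * s - 1 \<in> J"
  proof -
    have "(u * ?c * w) * s - 1 = u * (b * ?c) - 1" by (simp add: w(2) algebra_simps)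
    moreover have "u * (b * ?c) - 1 \<in> J" using u IJ by blast
    ultimately show ?thesis by metis
  qed
  ultimately show "\<exists>I u. ideal_in (adjoin R a) I \<and> 1 \<notin> I \<and> finite_quotient (adjoin R a) I
      \<and> u \<in> adjoin R a \<and> u * s - 1 \<in> I"
    using J by blast
qed

lemma finitely_separated_of_int:
  "unital_subring (range (of_int :: int \<Rightarrow> 'a::{idom,ring_char_0}))"
  "finitely_separated (range (of_int :: int \<Rightarrow> 'a))"
proof -
  let ?Z = "range (of_int :: int \<Rightarrow> 'a)"
  show "unital_subring ?Z"
    unfolding unital_subring_def by (auto simp flip: of_int_diff of_int_mult intro: range_eqI[of _ _ 1])
  show "finitely_separated ?Z"
    unfolding finitely_separated_def
  proof (intro ballI impI)
    fix r :: 'a assume "r \<in> ?Z" "r \<noteq> 0"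
    then obtain n :: int where n: "r = of_int n" "n \<noteq> 0" by auto
    \<comment> \<open>Modulo \<open>n\<^sup>2 + 1 \<ge> 2\<close>, the number \<open>- n\<close> is an inverse of \<open>n\<close>.\<close>
    define m where "m = n * n + 1"
    have "n * n > 0" using n(2) by (metis mult_neg_neg mult_pos_pos linorder_neqE)
    then have m: "m \<ge> 2" by (simp add: m_def)
    define I :: "'a set" where "I = of_int ` {x. m dvd x}"
    have "ideal_in ?Z I" unfolding ideal_in_def
    proof (intro conjI ballI)
      show "0 \<in> I" unfolding I_def by (rule image_eqI[of _ _ 0]) auto
      show "I \<subseteq> ?Z" by (auto simp: I_def)
      show "x + y \<in> I" if "x \<in> I" "y \<in> I" for x y
        using that unfolding I_def by (auto simp flip: of_int_add)
      show "x * y \<in> I" if "x \<in> ?Z" "y \<in> I" for x y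
        using that unfolding I_def by (auto simp flip: of_int_mult)
    qed
    moreover have "1 \<notin> I"
    proof
      assume "1 \<in> I"
      then obtain x where "m dvd x" "of_int x = (1::'a)" by (auto simp: I_def)
      then show False using m zdvd_imp_le[of m 1] by auto
    qed
    moreover have "finite_quotient ?Z I" unfolding finite_quotient_def
    proof (intro exI conjI ballI)
      show "finite (of_int ` {0..<m} :: 'a set)" by simp
      fix x assume "x \<in> ?Z"
      then obtain k where k: "x = of_int k" by auto
      have "x - of_int (k mod m) = of_int (k - k mod m)" using k by simp
      also have "\<dots> \<in> I" unfolding I_def by (intro imageI) (simp add: minus_mod_eq_mult_div)
      finally show "\<exists>f\<in>of_int ` {0..<m}. x - f \<in> I" using m by auto
    qed
    moreover have "of_int (- n) \<in> ?Z" by blast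
    moreover have "of_int (- n) * r - 1 \<in> I"
    proof -
      have "of_int (- n) * r - 1 = of_int (- m)" by (simp add: n(1) m_def)
      moreover have "of_int (- m) \<in> I" unfolding I_def by (intro imageI) simp
      ultimately show ?thesis by metis
    qed
    ultimately show "\<exists>I u. ideal_in ?Z I \<and> 1 \<notin> I \<and> finite_quotient ?Z I \<and> u \<in> ?Z \<and> u * r - 1 \<in> I"
      by blast
  qed
qed

theorem finite_set_in_finitely_separated_subring:
  fixes E :: "'a::{idom,ring_char_0} set"
  assumes "finite E"
  shows "\<exists>R. unital_subring R \<and> finitely_separated R \<and> E \<subseteq> R"
  using assms
proof (induction E)
  case empty
  then show ?case using finitely_separated_of_int by blast
next
  case (insert a E)
  then obtain R where R: "unital_subring R" "finitely_separated R" "E \<subseteq> R" by blast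
  have "finitely_separated (adjoin R a)"
    using finitely_separated_adjoin_transcendental[OF R(1,2), of a]
      finitely_separated_adjoin_algebraic[OF R(1,2)] by blast
  moreover have "insert a E \<subseteq> adjoin R a"
    using in_adjoin[OF R(1)] subset_adjoin[OF R(1)] R(3) by blast
  ultimately show ?case using unital_subring_adjoin[OF R(1)] by blast
qed

section \<open>Representations of infinite simple groups\<close>

lemma matrix_rep_entries_in_subring:
  fixes G (structure) and M :: "'g \<Rightarrow> 'i \<Rightarrow> 'i \<Rightarrow> 'k::idom"
  assumes G: "group G" and X: "symmetric_generating_set G X" and R: "unital_subring R"
    and XR: "\<And>x i j. x \<in> X \<Longrightarrow> i \<in> S \<Longrightarrow> j \<in> S \<Longrightarrow> M x i j \<in> R"
    and one: "\<And>i j. i \<in> S \<Longrightarrow> j \<in> S \<Longrightarrow> M \<one>\<^bsub>G\<^esub> i j = of_bool (i = j)"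
    and mult: "\<And>g h i j. g \<in> carrier G \<Longrightarrow> h \<in> carrier G \<Longrightarrow> i \<in> S \<Longrightarrow> j \<in> S \<Longrightarrow>
                 M (g \<otimes>\<^bsub>G\<^esub> h) i j = (\<Sum>k\<in>S. M g i k * M h k j)"
    and g: "g \<in> carrier G" and ij: "i \<in> S" "j \<in> S"
  shows "M g i j \<in> R"
proof -
  interpret group G by (rule G)
  have Xc: "X \<subseteq> carrier G" and Xinv: "\<And>x. x \<in> X \<Longrightarrow> inv x \<in> X" and gen: "generate G X = carrier G"
    using X by (auto simp: symmetric_generating_set_def)
  have "\<forall>i\<in>S. \<forall>j\<in>S. M g i j \<in> R" if "g \<in> generate G X"
    using that
  proof induction
    case one
    then show ?case using assms(5) unital_subringD[OF R] by (auto simp: of_bool_def)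
  next
    case (eng h1 h2)
    then show ?case using gen
      by (auto simp: mult intro!: unital_subring_sum[OF R] unital_subringD[OF R])
  qed (use XR Xinv in auto)
  then show ?thesis using g ij gen by auto
qed

text \<open>
Malcev's argument. The entries of all matrices lie in a ring \<open>R\<close> in which a nonzero entry of
\<open>M g - 1\<close> survives modulo an ideal \<open>I\<close> of finite index. The elements that act as the identity modulo
\<open>I\<close> form a proper normal subgroup \<open>N\<close>, which is trivial by simplicity, while only finitely
many matrices modulo \<open>I\<close> are available for the infinitely many elements of \<open>G\<close>.
\<close>

theorem matrix_rep_of_infinite_simple_group_trivial:
  fixes G (structure) and M :: "'g \<Rightarrow> 'i \<Rightarrow> 'i \<Rightarrow> 'k::{idom,ring_char_0}"
  assumes simple: "is_simple G" and inf: "infinite (carrier G)"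
    and finX: "finite X" and X: "symmetric_generating_set G X" and S: "finite S"
    and one: "\<And>i j. i \<in> S \<Longrightarrow> j \<in> S \<Longrightarrow> M \<one>\<^bsub>G\<^esub> i j = of_bool (i = j)"
    and mult: "\<And>g h i j. g \<in> carrier G \<Longrightarrow> h \<in> carrier G \<Longrightarrow> i \<in> S \<Longrightarrow> j \<in> S \<Longrightarrow>
                 M (g \<otimes>\<^bsub>G\<^esub> h) i j = (\<Sum>k\<in>S. M g i k * M h k j)"
    and g: "g \<in> carrier G" and ij: "i \<in> S" "j \<in> S"
  shows "M g i j = of_bool (i = j)"
proof (rule ccontr)
  assume nontriv: "M g i j \<noteq> of_bool (i = j)"
  have grp: "group G" using simple by (simp add: is_simple_def)
  interpret group G by (rule grp)
  define E where "E = (\<lambda>(x, i, j). M x i j) ` (X \<times> S \<times> S)"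
  have "finite E" unfolding E_def using finX S by simp
  then obtain R where R: "unital_subring R" "finitely_separated R" "E \<subseteq> R"
    using finite_set_in_finitely_separated_subring by blast
  note RR = unital_subringD[OF R(1)]
  have MR: "M h k l \<in> R" if "h \<in> carrier G" "k \<in> S" "l \<in> S" for h k l
  proof (rule matrix_rep_entries_in_subring[where M = M, OF grp X R(1) _ one mult that])
    show "M x k l \<in> R" if "x \<in> X" "k \<in> S" "l \<in> S" for x k l
      using R(3) that by (force simp: E_def)
  qed
  have bR: "of_bool b \<in> R" for b using RR by (cases b) auto
  have "M g i j - of_bool (i = j) \<in> R" "M g i j - of_bool (i = j) \<noteq> 0"
    using MR[OF g ij] bR RR nontriv by auto
  then obtain I u where I: "ideal_in R I" "1 \<notin> I" "finite_quotient R I"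
    and u: "u \<in> R" "u * (M g i j - of_bool (i = j)) - 1 \<in> I"
    using R(2) by (auto simp: finitely_separated_def)
  note ID = ideal_inD[OF I(1)]
  note IM = ideal_in_minus[OF R(1) I(1)]
  have nI: "M g i j - of_bool (i = j) \<notin> I"
  proof
    assume "M g i j - of_bool (i = j) \<in> I"
    then have "u * (M g i j - of_bool (i = j)) \<in> I" using ID(4) u(1) by blast
    from IM(2)[OF this u(2)] I(2) show False by simp
  qed
  have prod_cong: "M (a \<otimes> c) k l - M (b \<otimes> d) k l \<in> I"
    if car: "a \<in> carrier G" "b \<in> carrier G" "c \<in> carrier G" "d \<in> carrier G"
      and ab: "\<And>k l. k \<in> S \<Longrightarrow> l \<in> S \<Longrightarrow> M a k l - M b k l \<in> I"
      and cd: "\<And>k l. k \<in> S \<Longrightarrow> l \<in> S \<Longrightarrow> M c k l - M d k l \<in> I"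
      and kl: "k \<in> S" "l \<in> S" for a b c d k l
  proof -
    have "M (a \<otimes> c) k l - M (b \<otimes> d) k l
        = (\<Sum>m\<in>S. M c m l * (M a k m - M b k m) + M b k m * (M c m l - M d m l))"
      using car kl by (simp add: mult algebra_simps sum_subtractf sum.distrib)
    also have "\<dots> \<in> I"
      using car kl by (intro ideal_in_sum[OF I(1)] ID(3) ID(4) MR ab cd)
    finally show ?thesis .
  qed
  define N where "N = {h \<in> carrier G. \<forall>k\<in>S. \<forall>l\<in>S. M h k l - M \<one> k l \<in> I}"
  have ND: "M h k l - M \<one> k l \<in> I" "h \<in> carrier G" if "h \<in> N" "k \<in> S" "l \<in> S" for h k l
    using that by (auto simp: N_def)
  have Nc: "h \<in> carrier G" if "h \<in> N" for h using that by (simp add: N_def)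
  have refl: "M h k l - M h k l \<in> I" for h k l using ID(2) by simp
  have invN: "inv h \<in> N" if "h \<in> N" for h
    unfolding N_def
  proof (intro CollectI conjI ballI)
    show "inv h \<in> carrier G" using Nc[OF that] by simp
    fix k l assume kl: "k \<in> S" "l \<in> S"
    have "M (inv h \<otimes> h) k l - M (inv h \<otimes> \<one>) k l \<in> I"
      using that Nc[OF that] kl by (intro prod_cong refl ND(1)) auto
    then have "- (M (inv h) k l - M \<one> k l) \<in> I" using Nc[OF that] by simp
    then have "- (- (M (inv h) k l - M \<one> k l)) \<in> I" by (rule IM(1))
    then show "M (inv h) k l - M \<one> k l \<in> I" by simp
  qed
  have "subgroup N G"
  proof (rule subgroupI)
    show "N \<subseteq> carrier G" by (auto simp: N_def)
    show "N \<noteq> {}" using ID(2) by (auto simp: N_def intro!: exI[of _ "\<one>"])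
    show "inv a \<in> N" if "a \<in> N" for a by (rule invN[OF that])
    fix a b assume ab: "a \<in> N" "b \<in> N"
    show "a \<otimes> b \<in> N" unfolding N_def
    proof (intro CollectI conjI ballI)
      show "a \<otimes> b \<in> carrier G" using ab Nc by simp
      fix k l assume kl: "k \<in> S" "l \<in> S"
      have "M (a \<otimes> b) k l - M (\<one> \<otimes> \<one>) k l \<in> I"
        using ab Nc kl by (intro prod_cong ND(1)) auto
      then show "M (a \<otimes> b) k l - M \<one> k l \<in> I" by simp
    qed
  qed
  moreover have "x \<otimes> h \<otimes> inv x \<in> N" if x: "x \<in> carrier G" and h: "h \<in> N" for x h
    unfolding N_def
  proof (intro CollectI conjI ballI)
    show "x \<otimes> h \<otimes> inv x \<in> carrier G" using x Nc[OF h] by simp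
    fix k l assume kl: "k \<in> S" "l \<in> S"
    have "M (x \<otimes> h \<otimes> inv x) k l - M (x \<otimes> \<one> \<otimes> inv x) k l \<in> I"
      using x Nc[OF h] h kl by (intro prod_cong refl ND(1)) auto
    then show "M (x \<otimes> h \<otimes> inv x) k l - M \<one> k l \<in> I" using x by simp
  qed
  ultimately have "N \<lhd> G" by (simp add: normal_inv_iff)
  moreover have "N \<noteq> carrier G"
  proof
    assume "N = carrier G"
    then have "M g i j - M \<one> i j \<in> I" using g ij by (intro ND(1)) auto
    then show False using nI one ij by simp
  qed
  ultimately have N1: "N = {\<one>}" using simple by (auto simp: is_simple_def)
  obtain F where F: "finite F" "\<And>r. r \<in> R \<Longrightarrow> \<exists>f\<in>F. r - f \<in> I"
    using I(3) by (auto simp: finite_quotient_def)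
  obtain \<rho> where \<rho>: "\<And>r. r \<in> R \<Longrightarrow> \<rho> r \<in> F \<and> r - \<rho> r \<in> I" using F(2) by metis
  define \<Phi> where "\<Phi> h = restrict (\<lambda>(k, l). \<rho> (M h k l)) (S \<times> S)" for h
  have "\<Phi> ` carrier G \<subseteq> (S \<times> S) \<rightarrow>\<^sub>E F"
    unfolding \<Phi>_def using \<rho> MR by (intro image_subsetI restrict_PiE_iff[THEN iffD2] ballI) auto
  then have "finite (\<Phi> ` carrier G)"
    using S F(1) by (intro finite_subset[OF _ finite_PiE[of "S \<times> S" "\<lambda>_. F"]]) auto
  then have "\<not> inj_on \<Phi> (carrier G)" using inf finite_imageD by blast
  then obtain a b where ab: "a \<in> carrier G" "b \<in> carrier G" "a \<noteq> b" "\<Phi> a = \<Phi> b"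
    by (auto simp: inj_on_def)
  have abI: "M a k l - M b k l \<in> I" if kl: "k \<in> S" "l \<in> S" for k l
  proof -
    have "\<rho> (M a k l) = \<rho> (M b k l)"
      using fun_cong[OF ab(4), of "(k, l)"] kl by (simp add: \<Phi>_def)
    then have "(M a k l - \<rho> (M a k l)) - (M b k l - \<rho> (M b k l)) = M a k l - M b k l" by simp
    moreover have "(M a k l - \<rho> (M a k l)) - (M b k l - \<rho> (M b k l)) \<in> I"
      proof (rule IM(2))
      show "M a k l - \<rho> (M a k l) \<in> I" using \<rho> MR ab(1) kl by blast
      show "M b k l - \<rho> (M b k l) \<in> I" using \<rho> MR ab(2) kl by blast
    qed
    ultimately show ?thesis by simp
  qed
  have "a \<otimes> inv b \<in> N" unfolding N_def
  proof (intro CollectI conjI ballI)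
    show "a \<otimes> inv b \<in> carrier G" using ab by simp
    fix k l assume kl: "k \<in> S" "l \<in> S"
    have "M (a \<otimes> inv b) k l - M (b \<otimes> inv b) k l \<in> I"
      using ab kl by (intro prod_cong refl abI) auto
    then show "M (a \<otimes> inv b) k l - M \<one> k l \<in> I" using ab by simp
  qed
  then have "a \<otimes> inv b = \<one>" using N1 by simp
  then have "a = b" using ab by (metis inv_equality inv_inv inv_closed)
  with ab show False by simp
qed

text \<open>
A spanning subfamily modulo \<open>L\<close> of least cardinality is a basis modulo \<open>L\<close>.
\<close>

lemma (in vector_space) independent_modulo_subfamily:
  assumes L: "subspace L" and S0: "finite S0"
    and span: "\<And>w. w \<in> W \<Longrightarrow> \<exists>c. w - (\<Sum>i\<in>S0. c i *s b i) \<in> L"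
  shows "\<exists>S\<subseteq>S0. (\<forall>w\<in>W. \<exists>c. w - (\<Sum>i\<in>S. c i *s b i) \<in> L) \<and>
           (\<forall>c. (\<Sum>i\<in>S. c i *s b i) \<in> L \<longrightarrow> (\<forall>i\<in>S. c i = 0))"
proof -
  define C where "C S \<longleftrightarrow> S \<subseteq> S0 \<and> (\<forall>w\<in>W. \<exists>c. w - (\<Sum>i\<in>S. c i *s b i) \<in> L)" for S
  have "C S0" using span by (auto simp: C_def)
  then obtain S where S: "C S" and min: "\<And>S'. C S' \<Longrightarrow> card S \<le> card S'"
    using ex_has_least_nat[of C S0 card] by blast
  have finS: "finite S" using S S0 by (auto simp: C_def intro: finite_subset)
  have "\<forall>i\<in>S. c i = 0" if c: "(\<Sum>i\<in>S. c i *s b i) \<in> L" for c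
  proof (rule ccontr)
    assume "\<not> (\<forall>i\<in>S. c i = 0)"
    then obtain k where k: "k \<in> S" "c k \<noteq> 0" by blast
    have "C (S - {k})" unfolding C_def
    proof (intro conjI ballI)
      show "S - {k} \<subseteq> S0" using S by (auto simp: C_def)
      fix w assume "w \<in> W"
      then obtain d where d: "w - (\<Sum>i\<in>S. d i *s b i) \<in> L" using S by (auto simp: C_def)
      \<comment> \<open>Eliminate the \<open>k\<close>-th vector from the combination \<open>d\<close> with the help of the relation \<open>c\<close>.\<close>
      define e where "e i = d i - d k / c k * c i" for i
      have ek: "e k = 0" using k by (simp add: e_def)
      have "(\<Sum>i\<in>S. e i *s b i) = (\<Sum>i\<in>S. d i *s b i) - (d k / c k) *s (\<Sum>i\<in>S. c i *s b i)"
        unfolding e_def by (simp add: scale_left_diff_distrib sum_subtractf scale_sum_right)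
      moreover have "(\<Sum>i\<in>S. e i *s b i) = (\<Sum>i\<in>S - {k}. e i *s b i)"
        using sum.remove[OF finS k(1), of "\<lambda>i. e i *s b i"] ek by simp
      ultimately have "w - (\<Sum>i\<in>S - {k}. e i *s b i)
          = (w - (\<Sum>i\<in>S. d i *s b i)) + (d k / c k) *s (\<Sum>i\<in>S. c i *s b i)" by simp
      also have "\<dots> \<in> L" using d c by (intro subspace_add[OF L] subspace_scale[OF L])
      finally show "\<exists>c. w - (\<Sum>i\<in>S - {k}. c i *s b i) \<in> L" by blast
    qed
    from min[OF this] show False using k finS card_Diff1_less[OF finS k(1)] by simp
  qed
  then show ?thesis using S unfolding C_def by blast
qed

text \<open>
The quotient space is not formed: with respect to a basis of \<open>W\<close> modulo \<open>L\<close> the action has a matrix,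
and uniqueness of coordinates modulo \<open>L\<close> turns the action into a matrix representation.
\<close>

theorem infinite_simple_group_acts_trivially_on_finite_quotient:
  fixes scale :: "'k::field_char_0 \<Rightarrow> 'v::ab_group_add \<Rightarrow> 'v"
  assumes V: "vector_space scale"
    and simple: "is_simple G" and inf: "infinite (carrier G)"
    and finX: "finite X" and X: "symmetric_generating_set G X"
    and L: "module.subspace scale L"
    and Tlin: "\<And>g. g \<in> carrier G \<Longrightarrow> Vector_Spaces.linear scale scale (T g)"
    and TW: "\<And>g w. g \<in> carrier G \<Longrightarrow> w \<in> W \<Longrightarrow> T g w \<in> W"
    and TL: "\<And>g w. g \<in> carrier G \<Longrightarrow> w \<in> L \<Longrightarrow> T g w \<in> L"
    and Tone: "\<And>w. w \<in> W \<Longrightarrow> T \<one>\<^bsub>G\<^esub> w = w"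
    and Tmult: "\<And>g h w. g \<in> carrier G \<Longrightarrow> h \<in> carrier G \<Longrightarrow> w \<in> W \<Longrightarrow> T (g \<otimes>\<^bsub>G\<^esub> h) w = T g (T h w)"
    and S0: "finite S0" and bW: "\<And>i. i \<in> S0 \<Longrightarrow> b i \<in> W"
    and span: "\<And>w. w \<in> W \<Longrightarrow> \<exists>c. w - (\<Sum>i\<in>S0. scale (c i) (b i)) \<in> L"
    and g: "g \<in> carrier G" and w: "w \<in> W"
  shows "T g w - w \<in> L"
proof -
  interpret vector_space scale by (rule V)
  interpret G: group G using simple by (simp add: is_simple_def)
  note Ladd = subspace_add[OF L] and Lscale = subspace_scale[OF L] and Ldiff = subspace_diff[OF L]
    and Lsum = subspace_sum[OF L]
  obtain S where S: "S \<subseteq> S0"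
    and spanS: "\<And>w. w \<in> W \<Longrightarrow> \<exists>c. w - (\<Sum>i\<in>S. scale (c i) (b i)) \<in> L"
    and ind: "\<And>c. (\<Sum>i\<in>S. scale (c i) (b i)) \<in> L \<Longrightarrow> \<forall>i\<in>S. c i = 0"
    using independent_modulo_subfamily[OF L S0 span] by metis
  have finS: "finite S" using S S0 by (rule finite_subset)
  have bWS: "b i \<in> W" if "i \<in> S" for i using S bW that by blast
  have uniq: "c i = d i" if c: "v - (\<Sum>i\<in>S. scale (c i) (b i)) \<in> L"
    and d: "v - (\<Sum>i\<in>S. scale (d i) (b i)) \<in> L" and i: "i \<in> S" for v c d i
  proof -
    have "(v - (\<Sum>i\<in>S. scale (d i) (b i))) - (v - (\<Sum>i\<in>S. scale (c i) (b i)))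
        = (\<Sum>i\<in>S. scale (c i - d i) (b i))"
      by (simp add: scale_left_diff_distrib sum_subtractf)
    with Ldiff[OF d c] have "(\<Sum>i\<in>S. scale (c i - d i) (b i)) \<in> L" by simp
    from ind[OF this] i show ?thesis by simp
  qed
  have "\<forall>h j. \<exists>c. h \<in> carrier G \<and> j \<in> S \<longrightarrow> T h (b j) - (\<Sum>i\<in>S. scale (c i) (b i)) \<in> L"
    using spanS TW bWS by blast
  then obtain N where N: "\<And>h j. h \<in> carrier G \<Longrightarrow> j \<in> S \<Longrightarrow> T h (b j) - (\<Sum>i\<in>S. scale (N h j i) (b i)) \<in> L"
    by metis
  have Tsum: "T h (\<Sum>i\<in>S. scale (c i) (b i)) = (\<Sum>i\<in>S. scale (c i) (T h (b i)))"
    and Tdiff: "T h (v - v') = T h v - T h v'" if "h \<in> carrier G" for h c v v'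
  proof -
    interpret T: Vector_Spaces.linear scale scale "T h" by (rule Tlin[OF that])
    show "T h (\<Sum>i\<in>S. scale (c i) (b i)) = (\<Sum>i\<in>S. scale (c i) (T h (b i)))"
      by (simp add: T.sum T.scale)
    show "T h (v - v') = T h v - T h v'" by (rule T.diff)
  qed
  have Tcomb: "T h v - (\<Sum>i\<in>S. scale (\<Sum>k\<in>S. N h k i * c k) (b i)) \<in> L"
    if h: "h \<in> carrier G" and v: "v - (\<Sum>i\<in>S. scale (c i) (b i)) \<in> L" for h v c
  proof -
    have "(\<Sum>i\<in>S. scale (\<Sum>k\<in>S. N h k i * c k) (b i))
        = (\<Sum>k\<in>S. scale (c k) (\<Sum>i\<in>S. scale (N h k i) (b i)))"
      by (simp add: scale_sum_right scale_sum_left mult.commute) (rule sum.swap)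
    then have "T h v - (\<Sum>i\<in>S. scale (\<Sum>k\<in>S. N h k i * c k) (b i))
        = T h (v - (\<Sum>i\<in>S. scale (c i) (b i)))
          + (\<Sum>k\<in>S. scale (c k) (T h (b k) - (\<Sum>i\<in>S. scale (N h k i) (b i))))"
      by (simp add: Tdiff[OF h] Tsum[OF h] scale_right_diff_distrib sum_subtractf)
    also have "\<dots> \<in> L" using h v by (intro Ladd TL Lsum Lscale N)
    finally show ?thesis .
  qed
  have trivial: "N h j i = of_bool (i = j)" if "h \<in> carrier G" "i \<in> S" "j \<in> S" for h i j
  proof (rule matrix_rep_of_infinite_simple_group_trivial[OF simple inf finX X finS,
        where M = "\<lambda>h i j. N h j i"])
    show "N \<one>\<^bsub>G\<^esub> j i = of_bool (i = j)" if ij: "i \<in> S" "j \<in> S" for i j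
    proof (rule uniq[OF N[OF G.one_closed ij(2)] _ ij(1)])
      have "(\<Sum>i\<in>S. scale (of_bool (i = j)) (b i)) = (\<Sum>i\<in>S. if i = j then b i else 0)"
        by (intro sum.cong) auto
      then show "T \<one>\<^bsub>G\<^esub> (b j) - (\<Sum>i\<in>S. scale (of_bool (i = j)) (b i)) \<in> L"
        using finS ij Tone[OF bWS[OF ij(2)]] subspace_0[OF L] by (simp add: sum.delta)
    qed
    show "N (x \<otimes>\<^bsub>G\<^esub> y) j i = (\<Sum>k\<in>S. N x k i * N y j k)"
      if x: "x \<in> carrier G" and y: "y \<in> carrier G" and ij: "i \<in> S" "j \<in> S" for x y i j
    proof (rule uniq[OF N[OF _ ij(2)] _ ij(1)])
      show "x \<otimes>\<^bsub>G\<^esub> y \<in> carrier G" using x y by simp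
      show "T (x \<otimes>\<^bsub>G\<^esub> y) (b j) - (\<Sum>i\<in>S. scale (\<Sum>k\<in>S. N x k i * N y j k) (b i)) \<in> L"
        unfolding Tmult[OF x y bWS[OF ij(2)]] by (rule Tcomb[OF x N[OF y ij(2)]])
    qed
  qed (use that in auto)
  obtain c where c: "w - (\<Sum>i\<in>S. scale (c i) (b i)) \<in> L" using spanS[OF w] by blast
  have "(\<Sum>i\<in>S. scale (\<Sum>k\<in>S. N g k i * c k) (b i)) = (\<Sum>i\<in>S. scale (c i) (b i))"
    using finS by (intro sum.cong refl) (simp add: trivial[OF g] of_bool_def if_distrib[of "\<lambda>x. x * _"] cong: if_cong)
  with Tcomb[OF g c] have "T g w - (\<Sum>i\<in>S. scale (c i) (b i)) \<in> L" by simp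
  from Ldiff[OF this c] show ?thesis by simp
qed

section \<open>Superpositions in weighted convolution algebras\<close>

lemma has_sum_sum:
  fixes f :: "'i \<Rightarrow> 'a \<Rightarrow> 'b::topological_comm_monoid_add"
  assumes "\<And>i. i \<in> B \<Longrightarrow> (f i has_sum s i) A"
  shows "((\<lambda>x. \<Sum>i\<in>B. f i x) has_sum (\<Sum>i\<in>B. s i)) A"
  using assms by (induction B rule: infinite_finite_induct) (auto intro: has_sum_add)

lemma has_sum_difference:
  fixes f g :: "'a \<Rightarrow> 'b::topological_ab_group_add"
  assumes "(f has_sum a) A" "(g has_sum b) A"
  shows "((\<lambda>x. f x - g x) has_sum (a - b)) A"
  using has_sum_add[OF assms(1), of "\<lambda>x. - g x" "- b"] assms(2) by (simp add: has_sum_uminus)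

lemma has_sum_at_point:
  fixes f :: "'a \<Rightarrow> 'b::{comm_monoid_add,topological_space}"
  assumes "a \<in> A" "\<And>x. x \<in> A \<Longrightarrow> x \<noteq> a \<Longrightarrow> f x = 0"
  shows "(f has_sum f a) A"
  by (rule has_sum_finite_neutralI[of "{a}"]) (use assms in auto)

text \<open>
The basis element \<open>\<delta>\<^sub>g\<close> of the group algebra.
\<close>

definition point_mass :: "'a \<Rightarrow> 'a \<Rightarrow> complex" where
  "point_mass g t = of_bool (t = g)"

locale weighted_group = group G for G (structure) +
  fixes \<omega> :: "'a \<Rightarrow> real"
  assumes weight_ge_1: "t \<in> carrier G \<Longrightarrow> 1 \<le> \<omega> t"
    and weight_mult: "s \<in> carrier G \<Longrightarrow> t \<in> carrier G \<Longrightarrow> \<omega> (s \<otimes> t) \<le> \<omega> s * \<omega> t"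
begin

definition wnorm :: "('a \<Rightarrow> complex) \<Rightarrow> real" where
  "wnorm f = (\<Sum>\<^sub>\<infinity>t\<in>carrier G. norm (f t) * \<omega> t)"

lemma beurlingI:
  "(\<And>t. t \<notin> carrier G \<Longrightarrow> f t = 0) \<Longrightarrow> (\<lambda>t. norm (f t) * \<omega> t) summable_on carrier G
    \<Longrightarrow> f \<in> beurling G \<omega>"
  by (simp add: beurling_def)

lemma beurlingD:
  assumes "f \<in> beurling G \<omega>"
  shows "t \<notin> carrier G \<Longrightarrow> f t = 0" "(\<lambda>t. norm (f t) * \<omega> t) summable_on carrier G"
  using assms by (auto simp: beurling_def)

lemma weight_nonneg: "t \<in> carrier G \<Longrightarrow> 0 \<le> \<omega> t"
  using weight_ge_1[of t] by simp

lemma beurling_summable: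
  assumes "f \<in> beurling G \<omega>"
  shows "f summable_on carrier G"
proof (rule abs_summable_summable, rule summable_on_comparison_test[OF beurlingD(2)[OF assms]])
  fix t assume "t \<in> carrier G"
  then show "norm (f t) \<le> norm (f t) * \<omega> t"
    using weight_ge_1[of t] mult_left_mono[of 1 "\<omega> t" "norm (f t)"] by simp
qed auto

lemma beurling_zero: "(\<lambda>t. 0) \<in> beurling G \<omega>"
  by (rule beurlingI) auto

lemma beurling_add:
  assumes f: "f \<in> beurling G \<omega>" and g: "g \<in> beurling G \<omega>"
  shows "(\<lambda>t. f t + g t) \<in> beurling G \<omega>" "wnorm (\<lambda>t. f t + g t) \<le> wnorm f + wnorm g"
proof -
  note s = summable_on_add[OF beurlingD(2)[OF f] beurlingD(2)[OF g]]
  have le: "norm (f t + g t) * \<omega> t \<le> norm (f t) * \<omega> t + norm (g t) * \<omega> t" if "t \<in> carrier G" for t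
    using mult_right_mono[OF norm_triangle_ineq[of "f t" "g t"] weight_nonneg[OF that]]
    by (simp add: distrib_right)
  have sum: "(\<lambda>t. norm (f t + g t) * \<omega> t) summable_on carrier G"
    by (rule summable_on_comparison_test[OF s]) (use le weight_nonneg in auto)
  show "(\<lambda>t. f t + g t) \<in> beurling G \<omega>"
    by (rule beurlingI[OF _ sum]) (use beurlingD(1)[OF f] beurlingD(1)[OF g] in auto)
  show "wnorm (\<lambda>t. f t + g t) \<le> wnorm f + wnorm g"
    unfolding wnorm_def infsum_add[OF beurlingD(2)[OF f] beurlingD(2)[OF g], symmetric]
    by (rule infsum_mono[OF sum s le])
qed

lemma beurling_cmult:
  assumes f: "f \<in> beurling G \<omega>"
  shows "(\<lambda>t. c * f t) \<in> beurling G \<omega>"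
proof (rule beurlingI)
  show "(\<lambda>t. norm (c * f t) * \<omega> t) summable_on carrier G"
    using summable_on_cmult_right[OF beurlingD(2)[OF f], of "norm c"]
    by (simp add: norm_mult mult.assoc)
qed (use beurlingD(1)[OF f] in auto)

lemma beurling_diff:
  assumes "f \<in> beurling G \<omega>" "g \<in> beurling G \<omega>"
  shows "(\<lambda>t. f t - g t) \<in> beurling G \<omega>"
  using beurling_add(1)[OF assms(1) beurling_cmult[OF assms(2), of "-1"]] by simp

lemma point_mass_beurling:
  assumes g: "g \<in> carrier G"
  shows "point_mass g \<in> beurling G \<omega>" "wnorm (point_mass g) = \<omega> g"
    "(point_mass g has_sum 1) (carrier G)"
proof -
  have "((\<lambda>t. norm (point_mass g t) * \<omega> t) has_sum norm (point_mass g g) * \<omega> g) (carrier G)"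
    by (rule has_sum_at_point[OF g]) (simp add: point_mass_def)
  then have s: "((\<lambda>t. norm (point_mass g t) * \<omega> t) has_sum \<omega> g) (carrier G)"
    by (simp add: point_mass_def)
  show "point_mass g \<in> beurling G \<omega>"
    by (rule beurlingI[OF _ has_sum_imp_summable[OF s]]) (use g in \<open>auto simp: point_mass_def\<close>)
  show "wnorm (point_mass g) = \<omega> g"
    unfolding wnorm_def by (rule infsumI[OF s])
  show "(point_mass g has_sum 1) (carrier G)"
    using has_sum_at_point[OF g, of "point_mass g"] by (simp add: point_mass_def)
qed

text \<open>
Adding up elements \<open>K t\<close> of norm \<open>O(\<omega> t)\<close> with coefficients \<open>f t\<close> is absolutely convergent in
the Beurling algebra. This Fubini statement serves twice: with \<open>K t\<close> a translate it gives
convolution, and with \<open>K t\<close> the coefficients of \<open>\<delta>\<^sub>t - \<delta>\<^sub>e\<close> with respect to the generators it gives the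
generation of the augmentation ideal.
\<close>

lemma superposition:
  assumes f: "f \<in> beurling G \<omega>" and K: "\<And>t. t \<in> carrier G \<Longrightarrow> K t \<in> beurling G \<omega>"
    and bound: "\<And>t. t \<in> carrier G \<Longrightarrow> wnorm (K t) \<le> C * \<omega> t"
    and h: "\<And>s. h s = (if s \<in> carrier G then \<Sum>\<^sub>\<infinity>t\<in>carrier G. f t * K t s else 0)"
  shows "h \<in> beurling G \<omega>"
    and "\<And>s. s \<in> carrier G \<Longrightarrow> ((\<lambda>t. f t * K t s) has_sum h s) (carrier G)"
    and "(\<Sum>\<^sub>\<infinity>s\<in>carrier G. h s) = (\<Sum>\<^sub>\<infinity>t\<in>carrier G. f t * (\<Sum>\<^sub>\<infinity>s\<in>carrier G. K t s))"
proof -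
  let ?C = "carrier G"
  \<comment> \<open>The weighted family is the one whose absolute sum is controlled by the norms; as the weight
  is at least \<open>1\<close>, it dominates the unweighted family.\<close>
  define F where "F = (\<lambda>(t, s). f t * K t s * of_real (\<omega> s))"
  have nF: "norm (F (t, s)) = norm (f t) * (norm (K t s) * \<omega> s)" if "s \<in> ?C" for t s
    using weight_nonneg[OF that] by (simp add: F_def norm_mult mult.assoc)
  have F: "F abs_summable_on ?C \<times> ?C"
    unfolding abs_summable_on_Sigma_iff
  proof (intro conjI ballI)
    fix t assume t: "t \<in> ?C"
    show "(\<lambda>s. F (t, s)) abs_summable_on ?C"
      using summable_on_cmult_right[OF beurlingD(2)[OF K[OF t]], of "norm (f t)"]
      by (simp add: nF cong: summable_on_cong)
  next
    have e: "(\<Sum>\<^sub>\<infinity>s\<in>?C. norm (F (t, s))) = norm (f t) * wnorm (K t)" for t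
      unfolding wnorm_def by (simp add: nF infsum_cmult_right' cong: infsum_cong)
    show "(\<lambda>t. \<Sum>\<^sub>\<infinity>s\<in>?C. norm (F (t, s))) abs_summable_on ?C"
    proof (rule summable_on_comparison_test[OF summable_on_cmult_right[OF beurlingD(2)[OF f], of C]])
      fix t assume t: "t \<in> ?C"
      have "0 \<le> wnorm (K t)" unfolding wnorm_def by (intro infsum_nonneg) (auto simp: weight_nonneg)
      then show "norm (\<Sum>\<^sub>\<infinity>s\<in>?C. norm (F (t, s))) \<le> C * (norm (f t) * \<omega> t)"
        unfolding e using mult_left_mono[OF bound[OF t], of "norm (f t)"] by (simp add: algebra_simps)
    qed simp
  qed
  have FK: "(\<lambda>(t, s). f t * K t s) abs_summable_on ?C \<times> ?C"
  proof (rule abs_summable_on_comparison_test[OF F])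
    fix p assume "p \<in> ?C \<times> ?C"
    then obtain t s where p: "p = (t, s)" "s \<in> ?C" by auto
    have "norm (K t s) \<le> norm (K t s) * \<omega> s"
      using weight_ge_1[OF p(2)] mult_left_mono[of 1 "\<omega> s" "norm (K t s)"] by simp
    then show "norm (case p of (t, s) \<Rightarrow> f t * K t s) \<le> norm (F p)"
      by (simp add: p nF norm_mult mult_left_mono)
  qed
  have swap: "(\<lambda>(s, t). F (t, s)) abs_summable_on ?C \<times> ?C"
    using F summable_on_swap[of "\<lambda>p. norm (F p)" ?C ?C] by (simp add: case_prod_unfold)
  then have rows: "(\<lambda>t. F (t, s)) abs_summable_on ?C" if "s \<in> ?C" for s
    using that unfolding abs_summable_on_Sigma_iff by simp
  have outer: "(\<lambda>s. \<Sum>\<^sub>\<infinity>t\<in>?C. norm (F (t, s))) summable_on ?C"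
    using summable_on_Sigma_banach[of "\<lambda>s t. norm (F (t, s))" ?C "\<lambda>_. ?C"] swap
    by (simp add: case_prod_unfold)
  have FKs: "(\<lambda>(t, s). f t * K t s) summable_on ?C \<times> ?C" by (rule abs_summable_summable[OF FK])
  have FKs': "(\<lambda>(s, t). f t * K t s) summable_on ?C \<times> ?C"
    using FKs summable_on_swap[of "\<lambda>(t, s). f t * K t s" ?C ?C] by simp
  show hs: "((\<lambda>t. f t * K t s) has_sum h s) ?C" if "s \<in> ?C" for s
    using summable_on_SigmaD1[OF FKs' that] that by (simp add: h)
  show "h \<in> beurling G \<omega>"
  proof (rule beurlingI[OF _ summable_on_comparison_test[OF outer]])
    fix s assume s: "s \<in> ?C"
    have "((\<lambda>t. F (t, s)) has_sum h s * of_real (\<omega> s)) ?C"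
      unfolding F_def using has_sum_cmult_left[OF hs[OF s]] by simp
    then have "norm (h s * of_real (\<omega> s)) \<le> (\<Sum>\<^sub>\<infinity>t\<in>?C. norm (F (t, s)))"
      using norm_infsum_bound[OF rows[OF s]] by (simp add: infsumI)
    then show "norm (h s) * \<omega> s \<le> (\<Sum>\<^sub>\<infinity>t\<in>?C. norm (F (t, s)))"
      using weight_nonneg[OF s] by (simp add: norm_mult)
  qed (auto simp: h weight_nonneg)
  have "(\<Sum>\<^sub>\<infinity>s\<in>?C. h s) = (\<Sum>\<^sub>\<infinity>s\<in>?C. \<Sum>\<^sub>\<infinity>t\<in>?C. f t * K t s)"
    by (intro infsum_cong) (simp add: h)
  also have "\<dots> = (\<Sum>\<^sub>\<infinity>t\<in>?C. \<Sum>\<^sub>\<infinity>s\<in>?C. f t * K t s)"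
    by (rule infsum_swap_banach[OF FKs'])
  also have "\<dots> = (\<Sum>\<^sub>\<infinity>t\<in>?C. f t * (\<Sum>\<^sub>\<infinity>s\<in>?C. K t s))"
    by (simp add: infsum_cmult_right')
  finally show "(\<Sum>\<^sub>\<infinity>s\<in>?C. h s) = (\<Sum>\<^sub>\<infinity>t\<in>?C. f t * (\<Sum>\<^sub>\<infinity>s\<in>?C. K t s))" .
qed

definition translate :: "'a \<Rightarrow> ('a \<Rightarrow> complex) \<Rightarrow> 'a \<Rightarrow> complex" where
  "translate g f = (\<lambda>t. if t \<in> carrier G then f (inv g \<otimes> t) else 0)"

lemma bij_betw_left_translation:
  assumes "g \<in> carrier G"
  shows "bij_betw (\<lambda>t. g \<otimes> t) (carrier G) (carrier G)"
  using assms by (intro bij_betw_byWitness[of _ "\<lambda>t. inv g \<otimes> t"]) (auto simp flip: m_assoc)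

lemma translate_beurling:
  assumes g: "g \<in> carrier G" and f: "f \<in> beurling G \<omega>"
  shows "translate g f \<in> beurling G \<omega>" "wnorm (translate g f) \<le> wnorm f * \<omega> g"
    "(\<Sum>\<^sub>\<infinity>t\<in>carrier G. translate g f t) = (\<Sum>\<^sub>\<infinity>t\<in>carrier G. f t)"
proof -
  let ?C = "carrier G"
  note bij = bij_betw_left_translation[OF g]
  have tr: "translate g f (g \<otimes> t) = f t" if "t \<in> ?C" for t
    using that g by (simp add: translate_def flip: m_assoc)
  note major = summable_on_cmult_left[OF beurlingD(2)[OF f], of "\<omega> g"]
  have le: "norm (translate g f (g \<otimes> t)) * \<omega> (g \<otimes> t) \<le> norm (f t) * \<omega> t * \<omega> g" if t: "t \<in> ?C" for t
    using mult_left_mono[OF weight_mult[OF g t], of "norm (f t)"]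
    by (simp add: tr[OF t] algebra_simps)
  have s: "(\<lambda>t. norm (translate g f (g \<otimes> t)) * \<omega> (g \<otimes> t)) summable_on ?C"
    by (rule summable_on_comparison_test[OF major]) (use le g weight_nonneg in auto)
  show "translate g f \<in> beurling G \<omega>"
    using s summable_on_reindex_bij_betw[OF bij, of "\<lambda>t. norm (translate g f t) * \<omega> t"]
    by (intro beurlingI) (auto simp: translate_def)
  have "wnorm (translate g f) = (\<Sum>\<^sub>\<infinity>t\<in>?C. norm (translate g f (g \<otimes> t)) * \<omega> (g \<otimes> t))"
    unfolding wnorm_def
    by (rule infsum_reindex_bij_betw[OF bij, of "\<lambda>t. norm (translate g f t) * \<omega> t", symmetric])
  also have "\<dots> \<le> (\<Sum>\<^sub>\<infinity>t\<in>?C. norm (f t) * \<omega> t * \<omega> g)"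
    by (rule infsum_mono[OF s major le])
  also have "\<dots> = wnorm f * \<omega> g" unfolding wnorm_def by (rule infsum_cmult_left')
  finally show "wnorm (translate g f) \<le> wnorm f * \<omega> g" .
  have "(\<Sum>\<^sub>\<infinity>t\<in>?C. translate g f t) = (\<Sum>\<^sub>\<infinity>t\<in>?C. translate g f (g \<otimes> t))"
    by (rule infsum_reindex_bij_betw[OF bij, symmetric])
  also have "\<dots> = (\<Sum>\<^sub>\<infinity>t\<in>?C. f t)" by (intro infsum_cong tr)
  finally show "(\<Sum>\<^sub>\<infinity>t\<in>?C. translate g f t) = (\<Sum>\<^sub>\<infinity>t\<in>?C. f t)" .
qed

lemma convolution_beurling:
  assumes a: "a \<in> beurling G \<omega>" and f: "f \<in> beurling G \<omega>"
  shows "convolution G a f \<in> beurling G \<omega>"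
    "(\<Sum>\<^sub>\<infinity>t\<in>carrier G. convolution G a f t) = (\<Sum>\<^sub>\<infinity>t\<in>carrier G. a t) * (\<Sum>\<^sub>\<infinity>t\<in>carrier G. f t)"
proof -
  have h: "convolution G a f s = (if s \<in> carrier G then \<Sum>\<^sub>\<infinity>t\<in>carrier G. a t * translate t f s else 0)" for s
    by (auto simp: convolution_def translate_def intro!: infsum_cong)
  note sp = superposition[OF a translate_beurling(1)[OF _ f] translate_beurling(2)[OF _ f] h]
  show "convolution G a f \<in> beurling G \<omega>" by (rule sp(1))
  have "(\<Sum>\<^sub>\<infinity>t\<in>carrier G. convolution G a f t)
      = (\<Sum>\<^sub>\<infinity>t\<in>carrier G. a t * (\<Sum>\<^sub>\<infinity>s\<in>carrier G. translate t f s))" by (rule sp(3))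
  also have "\<dots> = (\<Sum>\<^sub>\<infinity>t\<in>carrier G. a t * (\<Sum>\<^sub>\<infinity>s\<in>carrier G. f s))"
    by (intro infsum_cong) (simp add: translate_beurling(3)[OF _ f])
  also have "\<dots> = (\<Sum>\<^sub>\<infinity>t\<in>carrier G. a t) * (\<Sum>\<^sub>\<infinity>t\<in>carrier G. f t)"
    by (rule infsum_cmult_left')
  finally show "(\<Sum>\<^sub>\<infinity>t\<in>carrier G. convolution G a f t)
      = (\<Sum>\<^sub>\<infinity>t\<in>carrier G. a t) * (\<Sum>\<^sub>\<infinity>t\<in>carrier G. f t)" .
qed

lemma convolution_point_mass_left:
  assumes g: "g \<in> carrier G"
  shows "convolution G (point_mass g) f = translate g f"
proof
  fix t
  have "((\<lambda>s. point_mass g s * f (inv s \<otimes> t)) has_sum (point_mass g g * f (inv g \<otimes> t))) (carrier G)"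
    by (rule has_sum_at_point[OF g]) (simp add: point_mass_def)
  then show "convolution G (point_mass g) f t = translate g f t"
    by (simp add: convolution_def translate_def infsumI point_mass_def)
qed

lemma has_sum_convolution_point_mass_right:
  assumes g: "g \<in> carrier G" and t: "t \<in> carrier G"
  shows "((\<lambda>s. a s * point_mass g (inv s \<otimes> t)) has_sum a (t \<otimes> inv g)) (carrier G)"
proof -
  have "((\<lambda>s. a s * point_mass g (inv s \<otimes> t)) has_sum
      a (t \<otimes> inv g) * point_mass g (inv (t \<otimes> inv g) \<otimes> t)) (carrier G)"
  proof (rule has_sum_at_point[where a = "t \<otimes> inv g" and f = "\<lambda>s. a s * point_mass g (inv s \<otimes> t)"])
    show "a s * point_mass g (inv s \<otimes> t) = 0" if s: "s \<in> carrier G" "s \<noteq> t \<otimes> inv g" for s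
    proof -
      have "inv s \<otimes> t \<noteq> g"
      proof
        assume "inv s \<otimes> t = g"
        then have "s \<otimes> g = s \<otimes> (inv s \<otimes> t)" by simp
        also have "\<dots> = t" using s t by (simp flip: m_assoc)
        finally have "t = s \<otimes> g" by simp
        then have "s = t \<otimes> inv g" using s g by (simp add: m_assoc)
        with s show False by simp
      qed
      then show ?thesis by (simp add: point_mass_def)
    qed
  qed (use g t in simp)
  moreover have "inv (t \<otimes> inv g) \<otimes> t = g" using g t by (simp add: inv_mult_group m_assoc)
  ultimately show ?thesis by (simp add: point_mass_def)
qed

lemma convolution_point_mass_difference:
  assumes g: "g \<in> carrier G" and t: "t \<in> carrier G"
  shows "convolution G a (\<lambda>s. point_mass g s - point_mass \<one> s) t = a (t \<otimes> inv g) - a t"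
proof -
  have "((\<lambda>s. a s * (point_mass g (inv s \<otimes> t) - point_mass \<one> (inv s \<otimes> t))) has_sum
     (a (t \<otimes> inv g) - a t)) (carrier G)"
    using has_sum_difference[OF has_sum_convolution_point_mass_right[OF g t, of a]
        has_sum_convolution_point_mass_right[OF one_closed t, of a]] t
    by (simp add: algebra_simps)
  then show ?thesis using t by (simp add: convolution_def infsumI)
qed

lemma convolution_point_mass_one:
  assumes a: "a \<in> beurling G \<omega>"
  shows "convolution G a (point_mass \<one>) = a"
proof
  fix t
  show "convolution G a (point_mass \<one>) t = a t"
  proof (cases "t \<in> carrier G")
    case True
    then show ?thesis
      using has_sum_convolution_point_mass_right[OF one_closed True, of a]
      by (simp add: convolution_def infsumI)
  next
    case False
    then show ?thesis using beurlingD(1)[OF a False] by (simp add: convolution_def)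
  qed
qed

section \<open>The augmentation ideal\<close>

lemma augmentation_idealD:
  assumes "f \<in> augmentation_ideal G \<omega>"
  shows "f \<in> beurling G \<omega>" "(f has_sum 0) (carrier G)"
  using assms beurling_summable[of f] has_sum_infsum[of f "carrier G"]
  by (auto simp: augmentation_ideal_def)

lemma augmentation_idealI:
  assumes "f \<in> beurling G \<omega>" "(f has_sum 0) (carrier G)"
  shows "f \<in> augmentation_ideal G \<omega>"
  using assms by (auto simp: augmentation_ideal_def infsumI)

lemma left_ideal_augmentation_ideal: "left_ideal G \<omega> (augmentation_ideal G \<omega>)"
  unfolding left_ideal_def
proof (intro conjI ballI allI)
  show "augmentation_ideal G \<omega> \<subseteq> beurling G \<omega>" by (auto simp: augmentation_ideal_def)
  show "(\<lambda>t. 0) \<in> augmentation_ideal G \<omega>"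
    by (intro augmentation_idealI beurling_zero) simp
  fix f assume f: "f \<in> augmentation_ideal G \<omega>"
  note fD = augmentation_idealD[OF f]
  {
    fix g assume g: "g \<in> augmentation_ideal G \<omega>"
    note gD = augmentation_idealD[OF g]
    show "(\<lambda>t. f t + g t) \<in> augmentation_ideal G \<omega>"
      using has_sum_add[OF fD(2) gD(2)] by (intro augmentation_idealI beurling_add fD gD) simp
  next
    fix c
    show "(\<lambda>t. c * f t) \<in> augmentation_ideal G \<omega>"
      using has_sum_cmult_right[OF fD(2), of c] by (intro augmentation_idealI beurling_cmult fD) simp
  next
    fix a assume a: "a \<in> beurling G \<omega>"
    show "convolution G a f \<in> augmentation_ideal G \<omega>"
      using convolution_beurling[OF a fD(1)] f by (simp add: augmentation_ideal_def)
  }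
qed

lemma subtract_augmentation:
  assumes f: "f \<in> beurling G \<omega>"
  shows "(\<lambda>t. f t - (\<Sum>\<^sub>\<infinity>t\<in>carrier G. f t) * point_mass \<one> t) \<in> augmentation_ideal G \<omega>"
proof (rule augmentation_idealI)
  show "(\<lambda>t. f t - (\<Sum>\<^sub>\<infinity>t\<in>carrier G. f t) * point_mass \<one> t) \<in> beurling G \<omega>"
    using f by (intro beurling_diff beurling_cmult point_mass_beurling) auto
  show "((\<lambda>t. f t - (\<Sum>\<^sub>\<infinity>t\<in>carrier G. f t) * point_mass \<one> t) has_sum 0) (carrier G)"
    using has_sum_difference[OF has_sum_infsum[OF beurling_summable[OF f]]
        has_sum_cmult_right[OF point_mass_beurling(3)[OF one_closed], of "\<Sum>\<^sub>\<infinity>t\<in>carrier G. f t"]]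
    by simp
qed

lemma finite_codimension_augmentation_ideal: "finite_codimension G \<omega> (augmentation_ideal G \<omega>)"
  unfolding finite_codimension_def
proof (intro exI conjI ballI allI impI)
  show "(\<lambda>_. point_mass \<one>) i \<in> beurling G \<omega>" if "i < 1" for i :: nat
    by (simp add: point_mass_beurling)
  fix f assume f: "f \<in> beurling G \<omega>"
  show "(\<lambda>t. f t - (\<Sum>i<(1::nat). (\<lambda>_. \<Sum>\<^sub>\<infinity>t\<in>carrier G. f t) i * (\<lambda>_. point_mass \<one>) i t)) \<in> augmentation_ideal G \<omega>"
    using subtract_augmentation[OF f] by simp
qed

lemma augmentation_ideal_proper: "augmentation_ideal G \<omega> \<noteq> beurling G \<omega>"
proof
  assume "augmentation_ideal G \<omega> = beurling G \<omega>"
  then have "(\<Sum>\<^sub>\<infinity>t\<in>carrier G. point_mass \<one> t) = 0"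
    using point_mass_beurling(1)[OF one_closed] unfolding augmentation_ideal_def by blast
  then show False using infsumI[OF point_mass_beurling(3)[OF one_closed]] by simp
qed

lemma point_mass_difference_in_augmentation_ideal:
  assumes "g \<in> carrier G"
  shows "(\<lambda>s. point_mass g s - point_mass \<one> s) \<in> augmentation_ideal G \<omega>"
  using has_sum_difference[OF point_mass_beurling(3)[OF assms] point_mass_beurling(3)[OF one_closed]]
  by (intro augmentation_idealI beurling_diff point_mass_beurling assms one_closed) simp

text \<open>
The augmentation ideal has codimension one with complement spanned by the unit \<open>\<delta>\<^sub>e\<close>, so a strictly
larger left ideal contains the unit.
\<close>

lemma proper_left_ideal_containing_augmentation_ideal:
  assumes L: "left_ideal G \<omega> L" "L \<noteq> beurling G \<omega>" and sub: "augmentation_ideal G \<omega> \<subseteq> L"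
  shows "L = augmentation_ideal G \<omega>"
proof (rule ccontr)
  assume "L \<noteq> augmentation_ideal G \<omega>"
  then obtain f where f: "f \<in> L" "f \<notin> augmentation_ideal G \<omega>" using sub by blast
  have fB: "f \<in> beurling G \<omega>" using f L by (auto simp: left_ideal_def)
  define \<sigma> where "\<sigma> = (\<Sum>\<^sub>\<infinity>t\<in>carrier G. f t)"
  have \<sigma>: "\<sigma> \<noteq> 0" using f fB by (auto simp: augmentation_ideal_def \<sigma>_def)
  have "(\<lambda>t. f t - \<sigma> * point_mass \<one> t) \<in> L" using subtract_augmentation[OF fB] sub by (auto simp: \<sigma>_def)
  then have "(\<lambda>t. (- 1) * (f t - \<sigma> * point_mass \<one> t)) \<in> L" using L by (simp only: left_ideal_def)
  with f(1) have "(\<lambda>t. f t + (- 1) * (f t - \<sigma> * point_mass \<one> t)) \<in> L" using L by (simp only: left_ideal_def)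
  then have "(\<lambda>t. (1 / \<sigma>) * (f t + (- 1) * (f t - \<sigma> * point_mass \<one> t))) \<in> L"
    using L by (simp only: left_ideal_def)
  moreover have "(\<lambda>t. (1 / \<sigma>) * (f t + (- 1) * (f t - \<sigma> * point_mass \<one> t))) = point_mass \<one>"
    using \<sigma> by auto
  ultimately have one: "point_mass \<one> \<in> L" by simp
  have "a \<in> L" if "a \<in> beurling G \<omega>" for a
  proof -
    have "convolution G a (point_mass \<one>) \<in> L" using L one that by (auto simp: left_ideal_def)
    then show ?thesis using convolution_point_mass_one[OF that] by simp
  qed
  then show False using L by (auto simp: left_ideal_def)
qed

end

section \<open>The weight of exponential word length\<close>

locale word_weight = group G for G (structure) +
  fixes X :: "'a set"
  assumes finite_X: "finite X" and symmetric_generating: "symmetric_generating_set G X"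
begin

abbreviation word :: "'a list \<Rightarrow> 'a" where
  "word xs \<equiv> foldr (\<lambda>x y. x \<otimes> y) xs \<one>"

abbreviation \<omega> :: "'a \<Rightarrow> real" where
  "\<omega> \<equiv> exp_weight G X"

lemma X_carrier: "X \<subseteq> carrier G" and X_inv: "x \<in> X \<Longrightarrow> inv x \<in> X"
  and X_generate: "generate G X = carrier G"
  using symmetric_generating by (auto simp: symmetric_generating_set_def)

lemma word_closed: "set xs \<subseteq> X \<Longrightarrow> word xs \<in> carrier G"
  using X_carrier by (induction xs) auto

lemma word_append: "set xs \<subseteq> X \<Longrightarrow> set ys \<subseteq> X \<Longrightarrow> word (xs @ ys) = word xs \<otimes> word ys"
  using X_carrier by (induction xs) (auto simp: word_closed m_assoc subset_iff)

lemma word_snoc: "set xs \<subseteq> X \<Longrightarrow> x \<in> X \<Longrightarrow> word (xs @ [x]) = word xs \<otimes> x"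
  using word_append[of xs "[x]"] X_carrier by auto

lemma word_exists:
  assumes "t \<in> carrier G"
  shows "\<exists>xs. set xs \<subseteq> X \<and> word xs = t"
proof -
  have "t \<in> generate G X" using assms X_generate by simp
  then show ?thesis
  proof induction
    case one
    show ?case by (rule exI[of _ "[]"]) simp
  next
    case (incl h)
    then show ?case using X_carrier by (intro exI[of _ "[h]"]) auto
  next
    case (inv h)
    then show ?case using X_carrier X_inv[OF inv] by (intro exI[of _ "[inv h]"]) auto
  next
    case (eng h1 h2)
    then obtain xs ys where "set xs \<subseteq> X" "word xs = h1" "set ys \<subseteq> X" "word ys = h2" by blast
    then show ?case using word_append[of xs ys] by (intro exI[of _ "xs @ ys"]) simp
  qed
qed

lemma geodesic_word_exists:
  assumes "t \<in> carrier G"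
  shows "\<exists>xs. set xs \<subseteq> X \<and> word xs = t \<and> length xs = word_length G X t"
proof -
  obtain xs where "set xs \<subseteq> X" "word xs = t" using word_exists[OF assms] by blast
  then have "\<exists>n xs. length xs = n \<and> set xs \<subseteq> X \<and> word xs = t" by blast
  from LeastI_ex[OF this] show ?thesis unfolding word_length_def by blast
qed

lemma word_length_le: "set xs \<subseteq> X \<Longrightarrow> word_length G X (word xs) \<le> length xs"
  unfolding word_length_def by (rule Least_le) blast

lemma weight_word_le: "set xs \<subseteq> X \<Longrightarrow> \<omega> (word xs) \<le> 2 ^ length xs"
  unfolding exp_weight_def by (intro power_increasing word_length_le) auto

sublocale weighted_group G "exp_weight G X"
proof
  show "1 \<le> \<omega> t" for t by (simp add: exp_weight_def)
  fix s t assume "s \<in> carrier G" "t \<in> carrier G"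
  then obtain xs ys where "set xs \<subseteq> X" "word xs = s" "length xs = word_length G X s"
      "set ys \<subseteq> X" "word ys = t" "length ys = word_length G X t"
    using geodesic_word_exists by metis
  then show "\<omega> (s \<otimes> t) \<le> \<omega> s * \<omega> t"
    using weight_word_le[of "xs @ ys"] word_append[of xs ys] by (simp add: exp_weight_def power_add)
qed

text \<open>
Telescoping along the word: the coefficient \<open>D x\<close> is the sum of the point masses at the prefixes
that are followed by the letter \<open>x\<close>. The point mass added in the step from \<open>xs\<close> to \<open>xs @ [y]\<close> has norm at most
\<open>2\<^bsup>length xs\<^esup>\<close>, which doubles the bound; this is why the exponential weight is the right one. Convolution by
\<open>\<delta>\<^sub>x - \<delta>\<^sub>e\<close> on the right is written out as \<open>D x (s \<otimes> inv x) - D x s\<close>.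
\<close>

lemma word_difference_decomposition:
  assumes "set xs \<subseteq> X"
  shows "\<exists>D. (\<forall>x\<in>X. D x \<in> beurling G \<omega> \<and> wnorm (D x) \<le> 2 ^ length xs) \<and>
    (\<forall>s\<in>carrier G. (\<Sum>x\<in>X. D x (s \<otimes> inv x) - D x s) = point_mass (word xs) s - point_mass \<one> s)"
  using assms
proof (induction xs rule: rev_induct)
  case Nil
  show ?case
    by (rule exI[of _ "\<lambda>x t. 0"]) (auto simp: beurling_zero wnorm_def)
next
  case (snoc y xs)
  then have xs: "set xs \<subseteq> X" and y: "y \<in> X" "y \<in> carrier G" using X_carrier by auto
  obtain D where D: "\<And>x. x \<in> X \<Longrightarrow> D x \<in> beurling G \<omega>" "\<And>x. x \<in> X \<Longrightarrow> wnorm (D x) \<le> 2 ^ length xs"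
    "\<And>s. s \<in> carrier G \<Longrightarrow> (\<Sum>x\<in>X. D x (s \<otimes> inv x) - D x s) = point_mass (word xs) s - point_mass \<one> s"
    using snoc.IH[OF xs] by blast
  let ?u = "word xs"
  have u: "?u \<in> carrier G" by (rule word_closed[OF xs])
  define D' where "D' x = (if x = y then (\<lambda>t. D x t + point_mass ?u t) else D x)" for x
  have "D' x \<in> beurling G \<omega> \<and> wnorm (D' x) \<le> 2 ^ length (xs @ [y])" if x: "x \<in> X" for x
  proof (cases "x = y")
    case True
    have "wnorm (\<lambda>t. D x t + point_mass ?u t) \<le> 2 ^ length xs + 2 ^ length xs"
      using beurling_add(2)[OF D(1)[OF x] point_mass_beurling(1)[OF u]] D(2)[OF x]
        point_mass_beurling(2)[OF u] weight_word_le[OF xs] by linarith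
    moreover have "(\<lambda>t. D x t + point_mass ?u t) \<in> beurling G \<omega>"
      by (rule beurling_add(1)[OF D(1)[OF x] point_mass_beurling(1)[OF u]])
    ultimately show ?thesis using True by (simp add: D'_def)
  next
    case False
    then show ?thesis using D(1,2)[OF x] by (auto simp: D'_def intro: order.trans)
  qed
  moreover have "(\<Sum>x\<in>X. D' x (s \<otimes> inv x) - D' x s) = point_mass (word (xs @ [y])) s - point_mass \<one> s"
    if s: "s \<in> carrier G" for s
  proof -
    have "s \<otimes> inv y = ?u \<longleftrightarrow> s = ?u \<otimes> y"
      using inv_solve_right[OF u s y(2)] by auto
    then have pm: "point_mass ?u (s \<otimes> inv y) = point_mass (word (xs @ [y])) s"
      by (simp only: point_mass_def word_snoc[OF xs y(1)])
    have "(\<Sum>x\<in>X. D' x (s \<otimes> inv x) - D' x s) = (\<Sum>x\<in>X. (D x (s \<otimes> inv x) - D x s)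
        + (if x = y then point_mass ?u (s \<otimes> inv y) - point_mass ?u s else 0))"
      by (intro sum.cong) (auto simp: D'_def)
    also have "\<dots> = point_mass ?u s - point_mass \<one> s + (point_mass ?u (s \<otimes> inv y) - point_mass ?u s)"
      using D(3)[OF s] finite_X y(1) by (simp add: sum.distrib sum.delta)
    finally show ?thesis unfolding pm by simp
  qed
  ultimately show ?case by (intro exI[of _ D']) blast
qed

text \<open>
Adding up the decompositions of \<open>\<delta>\<^sub>t - \<delta>\<^sub>e\<close>, along shortest words for \<open>t\<close>, with coefficients \<open>f t\<close> decomposes
\<open>f - (\<Sum>\<^sub>t f t) \<delta>\<^sub>e = f\<close>.
\<close>

lemma augmentation_ideal_decomposition:
  assumes f: "f \<in> augmentation_ideal G \<omega>"
  shows "\<exists>F. (\<forall>x\<in>X. F x \<in> beurling G \<omega>) \<and>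
    f = (\<lambda>s. \<Sum>x\<in>X. convolution G (F x) (\<lambda>t. point_mass x t - point_mass \<one> t) s)"
proof -
  note fD = augmentation_idealD[OF f]
  have "\<exists>D. \<forall>t\<in>carrier G. (\<forall>x\<in>X. D t x \<in> beurling G \<omega> \<and> wnorm (D t x) \<le> \<omega> t) \<and>
    (\<forall>s\<in>carrier G. (\<Sum>x\<in>X. D t x (s \<otimes> inv x) - D t x s) = point_mass t s - point_mass \<one> s)"
  proof (rule bchoice, rule ballI)
    fix t assume "t \<in> carrier G"
    then obtain xs where "set xs \<subseteq> X" "word xs = t" "length xs = word_length G X t"
      using geodesic_word_exists by blast
    then show "\<exists>D. (\<forall>x\<in>X. D x \<in> beurling G \<omega> \<and> wnorm (D x) \<le> \<omega> t) \<and>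
        (\<forall>s\<in>carrier G. (\<Sum>x\<in>X. D x (s \<otimes> inv x) - D x s) = point_mass t s - point_mass \<one> s)"
      using word_difference_decomposition[of xs] by (simp add: exp_weight_def)
  qed
  then obtain D where D_all: "\<forall>t\<in>carrier G. (\<forall>x\<in>X. D t x \<in> beurling G \<omega> \<and> wnorm (D t x) \<le> \<omega> t) \<and>
    (\<forall>s\<in>carrier G. (\<Sum>x\<in>X. D t x (s \<otimes> inv x) - D t x s) = point_mass t s - point_mass \<one> s)" ..
  have D: "\<And>t x. t \<in> carrier G \<Longrightarrow> x \<in> X \<Longrightarrow> D t x \<in> beurling G \<omega>"
    "\<And>t x. t \<in> carrier G \<Longrightarrow> x \<in> X \<Longrightarrow> wnorm (D t x) \<le> 1 * \<omega> t"
    "\<And>t s. t \<in> carrier G \<Longrightarrow> s \<in> carrier G \<Longrightarrow>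
       (\<Sum>x\<in>X. D t x (s \<otimes> inv x) - D t x s) = point_mass t s - point_mass \<one> s"
    using D_all by simp_all
  define F where "F x s = (if s \<in> carrier G then \<Sum>\<^sub>\<infinity>t\<in>carrier G. f t * D t x s else 0)" for x s
  have FB: "F x \<in> beurling G \<omega>" 
    and Fsum: "\<And>s. s \<in> carrier G \<Longrightarrow> ((\<lambda>t. f t * D t x s) has_sum F x s) (carrier G)" if x: "x \<in> X" for x
    using superposition[where h = "F x" and C = 1 and K = "\<lambda>t. D t x", OF fD(1) D(1)[OF _ x] D(2)[OF _ x] F_def]
    by blast+
  have "f s = (\<Sum>x\<in>X. convolution G (F x) (\<lambda>t. point_mass x t - point_mass \<one> t) s)" for s
  proof (cases "s \<in> carrier G")
    case s: True
    have "((\<lambda>t. \<Sum>x\<in>X. f t * D t x (s \<otimes> inv x) - f t * D t x s) has_sum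
        (\<Sum>x\<in>X. F x (s \<otimes> inv x) - F x s)) (carrier G)"
      using s X_carrier by (intro has_sum_sum has_sum_difference Fsum) auto
    moreover have "(\<Sum>x\<in>X. f t * D t x (s \<otimes> inv x) - f t * D t x s) = f t * point_mass t s - f t * point_mass \<one> s"
      if "t \<in> carrier G" for t
      using D(3)[OF that s] by (simp only: sum_distrib_left [symmetric] right_diff_distrib [symmetric])
    ultimately have "((\<lambda>t. f t * point_mass t s - f t * point_mass \<one> s) has_sum
        (\<Sum>x\<in>X. F x (s \<otimes> inv x) - F x s)) (carrier G)"
      by (simp cong: has_sum_cong)
    moreover have "((\<lambda>t. f t * point_mass t s - f t * point_mass \<one> s) has_sum
        (f s * point_mass s s - 0 * point_mass \<one> s)) (carrier G)"
    proof (rule has_sum_difference)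
      show "((\<lambda>t. f t * point_mass t s) has_sum f s * point_mass s s) (carrier G)"
        by (rule has_sum_at_point[where a = s and f = "\<lambda>t. f t * point_mass t s"])
          (use s in \<open>auto simp: point_mass_def\<close>)
      show "((\<lambda>t. f t * point_mass \<one> s) has_sum 0 * point_mass \<one> s) (carrier G)"
        by (rule has_sum_cmult_left[OF fD(2)])
    qed
    ultimately have "(\<Sum>x\<in>X. F x (s \<otimes> inv x) - F x s) = f s"
      using has_sum_unique by (fastforce simp: point_mass_def)
    moreover have "(\<Sum>x\<in>X. convolution G (F x) (\<lambda>t. point_mass x t - point_mass \<one> t) s)
        = (\<Sum>x\<in>X. F x (s \<otimes> inv x) - F x s)"
      using X_carrier s by (intro sum.cong refl convolution_point_mass_difference) auto
    ultimately show ?thesis by simp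
  next
    case False
    then show ?thesis using beurlingD(1)[OF fD(1) False] by (simp add: convolution_def)
  qed
  then show ?thesis using FB by (intro exI[of _ F]) auto
qed

lemma left_ideal_sum:
  assumes L: "left_ideal G \<omega> L" and "\<And>i. i \<in> A \<Longrightarrow> g i \<in> L"
  shows "(\<lambda>t. \<Sum>i\<in>A. g i t) \<in> L"
  using assms(2) L by (induction A rule: infinite_finite_induct) (auto simp: left_ideal_def)

lemma finitely_generated_augmentation_ideal:
  "finitely_generated_left_ideal G \<omega> (augmentation_ideal G \<omega>)"
proof -
  let ?A = "augmentation_ideal G \<omega>"
  obtain n and x :: "nat \<Rightarrow> 'a" where x: "bij_betw x {..<n} X"
    using ex_bij_betw_nat_finite[OF finite_X] by (metis atLeast0LessThan)
  then have xX: "x i \<in> X" if "i < n" for i using that by (auto simp: bij_betw_def)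
  define a where "a i = (\<lambda>t. point_mass (x i) t - point_mass \<one> t)" for i
  have a: "a i \<in> ?A" if "i < n" for i
    unfolding a_def using xX[OF that] X_carrier by (intro point_mass_difference_in_augmentation_ideal) auto
  have "?A = {(\<lambda>t. \<Sum>i<n. convolution G (f i) (a i) t) | f. \<forall>i<n. f i \<in> beurling G \<omega>}" (is "_ = ?S")
  proof
    show "?S \<subseteq> ?A"
    proof
      fix h assume "h \<in> ?S"
      then obtain f where h: "h = (\<lambda>t. \<Sum>i<n. convolution G (f i) (a i) t)"
        and f: "\<And>i. i < n \<Longrightarrow> f i \<in> beurling G \<omega>" by blast
      show "h \<in> ?A" unfolding h
      proof (rule left_ideal_sum[OF left_ideal_augmentation_ideal])
        show "convolution G (f i) (a i) \<in> ?A" if "i \<in> {..<n}" for i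
          using left_ideal_augmentation_ideal a f that by (simp add: left_ideal_def)
      qed
    qed
    show "?A \<subseteq> ?S"
    proof
      fix f assume f: "f \<in> ?A"
      obtain F where F: "\<And>y. y \<in> X \<Longrightarrow> F y \<in> beurling G \<omega>"
        "f = (\<lambda>s. \<Sum>y\<in>X. convolution G (F y) (\<lambda>t. point_mass y t - point_mass \<one> t) s)"
        using augmentation_ideal_decomposition[OF f] by blast
      have "f = (\<lambda>s. \<Sum>i<n. convolution G (F (x i)) (a i) s)"
        unfolding F(2) a_def by (intro ext sum.reindex_bij_betw[OF x, symmetric])
      then show "f \<in> ?S" using F(1) xX by (intro CollectI exI[of _ "\<lambda>i. F (x i)"]) auto
    qed
  qed
  then show ?thesis
    unfolding finitely_generated_left_ideal_def using left_ideal_augmentation_ideal a by blast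
qed

lemma augmentation_ideal_subset_left_ideal:
  assumes L: "left_ideal G \<omega> L"
    and X: "\<And>x. x \<in> X \<Longrightarrow> (\<lambda>t. point_mass x t - point_mass \<one> t) \<in> L"
  shows "augmentation_ideal G \<omega> \<subseteq> L"
proof
  fix f assume f: "f \<in> augmentation_ideal G \<omega>"
  obtain F where F: "\<And>x. x \<in> X \<Longrightarrow> F x \<in> beurling G \<omega>"
    "f = (\<lambda>s. \<Sum>x\<in>X. convolution G (F x) (\<lambda>t. point_mass x t - point_mass \<one> t) s)"
    using augmentation_ideal_decomposition[OF f] by blast
  show "f \<in> L" unfolding F(2)
  proof (rule left_ideal_sum[OF L])
    show "convolution G (F x) (\<lambda>t. point_mass x t - point_mass \<one> t) \<in> L" if "x \<in> X" for x
      using L F(1) X that by (simp add: left_ideal_def)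
  qed
qed

text \<open>
The group acts trivially modulo \<open>L\<close> by left translation, in particular on the class of \<open>\<delta>\<^sub>e\<close>. All
functions on the type form the ambient vector space here, and the Beurling algebra is the invariant subset \<open>W\<close>.
\<close>

lemma finite_codimension_left_ideal_contains_point_mass_difference:
  assumes simple: "is_simple G" and inf: "infinite (carrier G)"
    and L: "left_ideal G \<omega> L" and fin: "finite_codimension G \<omega> L" and g: "g \<in> carrier G"
  shows "(\<lambda>t. point_mass g t - point_mass \<one> t) \<in> L"
proof -
  define scale where "scale c f = (\<lambda>t. c * f t)" for c and f :: "'a \<Rightarrow> complex"
  interpret V: vector_space scale
    by standard (auto simp: scale_def fun_eq_iff algebra_simps)
  have sum_apply: "(\<Sum>i\<in>A. f i) t = (\<Sum>i\<in>A. f i t)" for A :: "nat set" and f :: "nat \<Rightarrow> 'a \<Rightarrow> complex" and t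
    by (induction A rule: infinite_finite_induct) auto
  obtain n and b :: "nat \<Rightarrow> 'a \<Rightarrow> complex" where b: "\<And>i. i < n \<Longrightarrow> b i \<in> beurling G \<omega>"
    and span: "\<And>f. f \<in> beurling G \<omega> \<Longrightarrow> \<exists>c. (\<lambda>t. f t - (\<Sum>i<n. c i * b i t)) \<in> L"
    using fin unfolding finite_codimension_def by blast
  have "translate g (point_mass \<one>) - point_mass \<one> \<in> L"
  proof (rule infinite_simple_group_acts_trivially_on_finite_quotient
      [where T = translate and W = "beurling G \<omega>" and ?S0.0 = "{..<n}" and b = b, OF V.vector_space_axioms simple inf
        finite_X symmetric_generating])
    show "V.subspace L"
      using L by (auto simp: V.subspace_def left_ideal_def scale_def zero_fun_def plus_fun_def)
    show "Vector_Spaces.linear scale scale (translate h)" for h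
      by standard (auto simp: translate_def scale_def plus_fun_def)
    show "translate h f \<in> L" if "h \<in> carrier G" "f \<in> L" for h f
    proof -
      have "convolution G (point_mass h) f \<in> L"
        using L that point_mass_beurling(1)[OF that(1)] by (simp add: left_ideal_def)
      then show ?thesis by (simp add: convolution_point_mass_left[OF that(1)])
    qed
    show "translate \<one> f = f" if "f \<in> beurling G \<omega>" for f
      using beurlingD(1)[OF that] by (auto simp: translate_def)
    show "translate (h \<otimes> k) f = translate h (translate k f)" if "h \<in> carrier G" "k \<in> carrier G" for h k f
      using that by (auto simp: translate_def inv_mult_group m_assoc)
    show "\<exists>c. f - (\<Sum>i\<in>{..<n}. scale (c i) (b i)) \<in> L" if f: "f \<in> beurling G \<omega>" for f
    proof -
      obtain c where c: "(\<lambda>t. f t - (\<Sum>i<n. c i * b i t)) \<in> L" using span[OF f] by blast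
      have "f - (\<Sum>i\<in>{..<n}. scale (c i) (b i)) = (\<lambda>t. f t - (\<Sum>i<n. c i * b i t))"
        by (rule ext) (simp add: sum_apply scale_def)
      with c show ?thesis by metis
    qed
  qed (use b g translate_beurling(1) point_mass_beurling(1) in auto)
  moreover have "translate g (point_mass \<one>) - point_mass \<one> = (\<lambda>t. point_mass g t - point_mass \<one> t)"
  proof
    fix t
    have "inv g \<otimes> t = \<one> \<longleftrightarrow> t = g" if "t \<in> carrier G"
      using inv_solve_left[OF one_closed g that] g by auto
    then show "(translate g (point_mass \<one>) - point_mass \<one>) t = point_mass g t - point_mass \<one> t"
      using g by (auto simp: translate_def point_mass_def)
  qed
  ultimately show ?thesis by simp
qed

end

theorem theorem1p3:
  fixes G :: "('a, 'm) monoid_scheme" and X :: "'a set" and \<omega> :: "'a \<Rightarrow> real"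
  assumes "group G" and "infinite (carrier G)" and "is_simple G"
    and "finite X" and "symmetric_generating_set G X"
    and "\<omega> = exp_weight G X"
  shows "{I. left_ideal G \<omega> I \<and> I \<noteq> beurling G \<omega> \<and> finite_codimension G \<omega> I}
           = {augmentation_ideal G \<omega>}
         \<and> finitely_generated_left_ideal G \<omega> (augmentation_ideal G \<omega>)"
proof -
  interpret word_weight G X
    using assms by (intro word_weight.intro word_weight_axioms.intro)
  have "L = augmentation_ideal G \<omega>"
    if L: "left_ideal G \<omega> L" "L \<noteq> beurling G \<omega>" "finite_codimension G \<omega> L" for L
  proof -
    have "augmentation_ideal G \<omega> \<subseteq> L"
      using L X_carrier unfolding assms(6)
      by (intro augmentation_ideal_subset_left_ideal
          finite_codimension_left_ideal_contains_point_mass_difference[OF assms(3,2)]) auto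
    then show ?thesis
      using proper_left_ideal_containing_augmentation_ideal L unfolding assms(6) by blast
  qed
  then show ?thesis
    using left_ideal_augmentation_ideal augmentation_ideal_proper
      finite_codimension_augmentation_ideal finitely_generated_augmentation_ideal
    unfolding assms(6) by blast
qed

end
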